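(* Let $\tau=213$. Let $\{X_n\}_{n=1}^\infty$, $\{\hat X_n\}_{n=1}^\infty$, $\{Y_n^{(1)}\}_{n=1}^\infty$, $\{Y_n^{(2)}\}_{n=1}^\infty$ and $\chi_{0,1}$ be mutually independent random variables, where the $X_n$ are IID with $P(X_n=k)=\frac{C_k}{2\cdot4^k}$, $k=0,1,2,\dots$; the $\hat X_n$ are IID with $\hat X_n$ distributed as $X_1+1$; for $i=1,2$ the $Y^{(i)}_n$ are IID with $P(Y^{(i)}_n=k)=(\frac12)^k$, $k\in\mathbb{N}$; and $P(\chi_{0,1}=0)=P(\chi_{0,1}=1)=\frac12$. Let $T_0^{\hat X}=T_0^{Y^{(1)}}=T_0^{Y^{(2)}}=0$, $T_n^{\hat X}=\sum_{j=1}^n\hat X_j$ and $T_n^{Y^{(i)}}=\sum_{j=1}^nY_j^{(i)}$, $i=1,2$. Then, as $n\to\infty$, $\mu_n^{213}$ converges weakly, as probability measures on $S(\mathbb{N},\mathbb{N}^* )$, to the distribution of the random variable $$\chi_{0,1}\cdot\big(\infty^{(J)}*I^{(1)}\big)+(1-\chi_{0,1})\cdot\big(\infty^{(J)}*I^{(0)}\big)$$ (that is, the random variable equal to $\infty^{(J)}*I^{(1)}$ if $\chi_{0,1}=1$ and to $\infty^{(J)}*I^{(0)}$ if $\chi_{0,1}=0$), where $J=\{X_n\}_{n=1}^\infty$ and $$I^{(1)}=\bigcup_{n=0}^\infty\Big[T_n^{Y^{(1)}}+T^{\hat X}_{T_n^{Y^{(2)}}}+1,\ T_{n+1}^{Y^{(1)}}+T^{\hat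 X}_{T_n^{Y^{(2)}}}\Big],\qquad I^{(0)}=\bigcup_{n=0}^\infty\Big[T_n^{Y^{(1)}}+T^{\hat X}_{T_{n+1}^{Y^{(2)}}}+1,\ T_{n+1}^{Y^{(1)}}+T^{\hat X}_{T_{n+1}^{Y^{(2)}}}\Big].$$ This random variable takes values (almost surely) in $S(\mathbb{N},\mathbb{N}^* )-S(\mathbb{N},\mathbb{N})-S_{\text{sur}}(\mathbb{N},\mathbb{N}^* )$.
   Context: $\mathbb{N}=\{1,2,\dots\}$ and $[n]=\{1,\dots,n\}$; $[a,b]=\{a,\dots,b\}\subset\mathbb{N}$ for $a\le b$. $C_n=\frac{1}{n+1}\binom{2n}{n}$ is the $n$th Catalan number. $S_n$ is the set of permutations $\sigma=\sigma_1\cdots\sigma_n$ of $[n]$. For $\tau=\tau_1\cdots\tau_m\in S_m$, $\sigma\in S_n$ contains $\tau$ if there are indices $i_1<\cdots<i_m$ such that for all $1\le j,k\le m$, $\sigma_{i_j}<\sigma_{i_k}$ if and only if $\tau_j<\tau_k$; otherwise it avoids $\tau$. $S_n(\tau)$ is the set of $\tau$-avoiding permutations in $S_n$, and $\mu_n^\tau$ is the uniform probability measure on $S_n(\tau)$. $\mathbb{N}^*=\mathbb{N}\cup\{\infty\}$ carries the metric $d_{\mathbb{N}^*}(i,j)=\sum_{k=i}^{j-1}2^{-k}$ for $1\le i<j\le\infty$. $S(\mathbb{N},\mathbb{N}^* )$ is the set of functions $\sigma=\{\sigma_i\}_{i=1}^\infty$ from $\mathbb{N}$ to $\mathbb{N}^*$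 that are injective on $\sigma^{-1}(\mathbb{N})$, with the metric $D(\sigma,\rho)=\sum_{i=1}^\infty 2^{-i}d_{\mathbb{N}^*}(\sigma_i,\rho_i)$; it is a compact metric space. $S(\mathbb{N},\mathbb{N})\subset S(\mathbb{N},\mathbb{N}^* )$ is the subset of injections $\mathbb{N}\to\mathbb{N}$, and $S_{\text{sur}}(\mathbb{N},\mathbb{N}^* )\subset S(\mathbb{N},\mathbb{N}^* )$ is the subset of surjections from $\mathbb{N}$ onto $\mathbb{N}^*$; $A-B-C$ denotes the set of elements of $A$ lying in neither $B$ nor $C$. $S_n$ is regarded as a subset of $S(\mathbb{N},\mathbb{N}^* )$ by setting $\sigma_j=j$ for $j>n$, so $\mu_n^\tau$ is a probability measure on $S(\mathbb{N},\mathbb{N}^* )$. $\infty^{(j)}$ denotes the listing $(\infty\ \infty\cdots\infty)$ with $j$ terms (the empty listing if $j=0$); $(a)$ denotes the one-term listing with entry $a$. The symbol $*$ denotes concatenation of listings: an infinite concatenation of finite listings is read, from left to right, as the sequence of values $\sigma_1,\sigma_2,\dots$ of a function $\sigma$ on $\mathbb{N}$. For a sequence $J=\{J_n\}_{n=1}^\infty$ of nonnegative integers and an infinite set $I\subset\mathbb{N}$ whose elements in increasing order are $i_1<i_2<\cdots$, define $$\infty^{(J)}*I=\infty^{(J_1)}*(i_1)*\infty^{(J_2)}*(i_2)*\cdots.$$ *)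

theory Defs
  imports "HOL-Probability.Probability" "HOL-Library.Stream" "HOL-Combinatorics.Permutations"
begin

definition catalan :: "nat \<Rightarrow> real" where
  "catalan n = real ((2 * n) choose n) / (real n + 1)"

subsection \<open>The metric space of generalised permutations\<close>

text \<open>
  The positive integers are \<open>{1..} :: nat set\<close>; as a subset of \<open>enat\<close> they are \<open>enat ` {1..}\<close>, and
  together with \<open>\<infinity>\<close> they form \<open>{1..} :: enat set\<close>.  Functions on the positive integers are
  extensional, i.e. they take the value \<open>undefined\<close> at \<open>0\<close>.
\<close>

definition S_ext :: "(nat \<Rightarrow> enat) set" where
  "S_ext = {\<sigma> \<in> {1..} \<rightarrow>\<^sub>E {1..}. inj_on \<sigma> ({1..} \<inter> \<sigma> -` (enat ` {1..}))}"

definition S_inj :: "(nat \<Rightarrow> enat) set" where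
  "S_inj = {\<sigma> \<in> {1..} \<rightarrow>\<^sub>E enat ` {1..}. inj_on \<sigma> {1..}}"

definition S_sur :: "(nat \<Rightarrow> enat) set" where
  "S_sur = {\<sigma> \<in> S_ext. \<sigma> ` {1..} = {1..}}"

definition d_Nstar :: "enat \<Rightarrow> enat \<Rightarrow> real" where
  "d_Nstar i j = (\<Sum>\<^sub>\<infinity>k\<in>{k. min i j \<le> enat k \<and> enat k < max i j}. (1/2) ^ k)"

definition D_ext :: "(nat \<Rightarrow> enat) \<Rightarrow> (nat \<Rightarrow> enat) \<Rightarrow> real" where
  "D_ext \<sigma> \<rho> = (\<Sum>\<^sub>\<infinity>i\<in>{1..}. (1/2) ^ i * d_Nstar (\<sigma> i) (\<rho> i))"

lemma half_summable: "(\<lambda>k::nat. (1/2::real) ^ k) summable_on A"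
proof -
  have "(\<lambda>k::nat. (1/2::real) ^ k) summable_on UNIV"
    by (rule norm_summable_imp_summable_on) simp
  then show ?thesis
    by (rule summable_on_subset) simp
qed

lemma d_Nstar_nonneg: "0 \<le> d_Nstar i j"
  unfolding d_Nstar_def by (rule infsum_nonneg) simp

lemma d_Nstar_commute: "d_Nstar i j = d_Nstar j i"
  unfolding d_Nstar_def by (simp add: min.commute max.commute)

lemma d_Nstar_le: "d_Nstar i j \<le> (\<Sum>\<^sub>\<infinity>k\<in>UNIV. (1/2) ^ k)"
  unfolding d_Nstar_def by (rule infsum_mono_neutral) (auto simp: half_summable)

lemma d_Nstar_eq_0: "d_Nstar i j = 0 \<longleftrightarrow> i = j"
proof
  assume "d_Nstar i j = 0"
  show "i = j"
  proof (rule ccontr)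
    assume "i \<noteq> j"
    then have lt: "min i j < max i j" by (cases i j rule: linorder_cases) auto
    then obtain k where "min i j = enat k" by (cases "min i j") auto
    note k = this lt
    have "(\<Sum>\<^sub>\<infinity>k\<in>{k}. (1/2::real) ^ k) \<le> d_Nstar i j"
      unfolding d_Nstar_def by (rule infsum_mono_neutral) (use k in \<open>auto simp: half_summable\<close>)
    with \<open>d_Nstar i j = 0\<close> have "(1/2::real) ^ k \<le> 0" by simp
    moreover have "(0::real) < (1/2) ^ k" by simp
    ultimately show False by linarith
  qed
next
  assume "i = j"
  then have "{k. min i j \<le> enat k \<and> enat k < max i j} = {}" by auto
  then show "d_Nstar i j = 0" unfolding d_Nstar_def by (simp only: infsum_empty)
qed

lemma d_Nstar_triangle: "d_Nstar i l \<le> d_Nstar i j + d_Nstar j l"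
proof -
  define A where "A i j = {k. min i j \<le> enat k \<and> enat k < max i j}" for i j :: enat
  have sub: "A i l \<subseteq> A i j \<union> (A j l - A i j)"
    unfolding A_def by (auto simp: min_def max_def split: if_splits)
  have "(\<Sum>\<^sub>\<infinity>k\<in>A i l. (1/2::real) ^ k) \<le> (\<Sum>\<^sub>\<infinity>k\<in>A i j \<union> (A j l - A i j). (1/2) ^ k)"
    by (rule infsum_mono_neutral) (use sub in \<open>auto simp: half_summable\<close>)
  also have "\<dots> = (\<Sum>\<^sub>\<infinity>k\<in>A i j. (1/2) ^ k) + (\<Sum>\<^sub>\<infinity>k\<in>A j l - A i j. (1/2) ^ k)"
    by (rule infsum_Un_disjoint) (auto simp: half_summable)
  also have "(\<Sum>\<^sub>\<infinity>k\<in>A j l - A i j. (1/2::real) ^ k) \<le> (\<Sum>\<^sub>\<infinity>k\<in>A j l. (1/2) ^ k)"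
    by (rule infsum_mono_neutral) (auto simp: half_summable)
  finally show ?thesis unfolding d_Nstar_def A_def by simp
qed

lemma D_ext_summable:
  "(\<lambda>i. (1/2) ^ i * d_Nstar (\<sigma> i) (\<rho> i)) summable_on A"
proof (rule summable_on_comparison_test[where f = "\<lambda>i. (1/2) ^ i * (\<Sum>\<^sub>\<infinity>k\<in>UNIV. (1/2) ^ k)"])
  show "(\<lambda>i. (1/2) ^ i * (\<Sum>\<^sub>\<infinity>k\<in>(UNIV::nat set). (1/2::real) ^ k)) summable_on A"
    by (intro summable_on_cmult_left half_summable)
qed (auto intro!: mult_left_mono d_Nstar_le mult_nonneg_nonneg d_Nstar_nonneg)

lemma Metric_space_S_ext: "Metric_space S_ext D_ext"
proof
  fix \<sigma> \<rho> \<pi>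
  show "0 \<le> D_ext \<sigma> \<rho>"
    unfolding D_ext_def by (intro infsum_nonneg mult_nonneg_nonneg d_Nstar_nonneg) simp
  show "D_ext \<sigma> \<rho> = D_ext \<rho> \<sigma>"
    unfolding D_ext_def by (simp add: d_Nstar_commute)
  show "D_ext \<sigma> \<rho> = 0 \<longleftrightarrow> \<sigma> = \<rho>" if "\<sigma> \<in> S_ext" "\<rho> \<in> S_ext"
  proof
    assume 0: "D_ext \<sigma> \<rho> = 0"
    have "\<sigma> i = \<rho> i" if "i \<in> {1..}" for i
    proof -
      have "(1/2) ^ i * d_Nstar (\<sigma> i) (\<rho> i) = 0"
      proof (rule nonneg_infsum_le_0D[OF _ D_ext_summable _ that])
        show "(\<Sum>\<^sub>\<infinity>i\<in>{1..}. (1/2) ^ i * d_Nstar (\<sigma> i) (\<rho> i)) \<le> 0"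
          using 0 unfolding D_ext_def by simp
      qed (auto intro: mult_nonneg_nonneg d_Nstar_nonneg)
      then show ?thesis by (simp add: d_Nstar_eq_0)
    qed
    with that show "\<sigma> = \<rho>" unfolding S_ext_def by (auto intro: PiE_ext)
  next
    assume "\<sigma> = \<rho>"
    moreover have "d_Nstar i i = 0" for i by (simp add: d_Nstar_eq_0)
    ultimately show "D_ext \<sigma> \<rho> = 0" unfolding D_ext_def by simp
  qed
  show "D_ext \<sigma> \<pi> \<le> D_ext \<sigma> \<rho> + D_ext \<rho> \<pi>"
  proof -
    have "D_ext \<sigma> \<pi> \<le> (\<Sum>\<^sub>\<infinity>i\<in>{1..}. (1/2) ^ i * d_Nstar (\<sigma> i) (\<rho> i) + (1/2) ^ i * d_Nstar (\<rho> i) (\<pi> i))"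
      unfolding D_ext_def
      by (intro infsum_mono summable_on_add D_ext_summable)
         (metis d_Nstar_triangle distrib_left mult_left_mono zero_le_power zero_le_divide_1_iff zero_le_numeral)
    also have "\<dots> = D_ext \<sigma> \<rho> + D_ext \<rho> \<pi>"
      unfolding D_ext_def by (intro infsum_add D_ext_summable)
    finally show ?thesis .
  qed
qed

abbreviation S_top :: "(nat \<Rightarrow> enat) topology" where
  "S_top \<equiv> Metric_space.mtopology S_ext D_ext"

subsection \<open>Borel measures on a topological space and weak convergence\<close>

definition borel_of :: "'a topology \<Rightarrow> 'a measure" where
  "borel_of X = sigma (topspace X) {U. openin X U}"

definition weak_conv_on :: "'a topology \<Rightarrow> (nat \<Rightarrow> 'a measure) \<Rightarrow> 'a measure \<Rightarrow> bool" where
  "weak_conv_on X Ms M \<longleftrightarrow>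
     (\<forall>n. prob_space (Ms n) \<and> sets (Ms n) = sets (borel_of X)) \<and>
     prob_space M \<and> sets M = sets (borel_of X) \<and>
     (\<forall>f :: 'a \<Rightarrow> real. continuous_map X euclideanreal f \<and> bounded (f ` topspace X) \<longrightarrow>
        (\<lambda>n. \<integral>x. f x \<partial>Ms n) \<longlonglongrightarrow> (\<integral>x. f x \<partial>M))"

subsection \<open>Pattern avoiding permutations\<close>

text \<open>A pattern is given by its one-line notation; list positions are counted from \<open>0\<close>.\<close>

definition contains_pattern :: "nat \<Rightarrow> (nat \<Rightarrow> nat) \<Rightarrow> nat list \<Rightarrow> bool" where
  "contains_pattern n \<sigma> \<tau> \<longleftrightarrow>
     (\<exists>i. strict_mono_on {1..length \<tau>} i \<and> i ` {1..length \<tau>} \<subseteq> {1..n} \<and>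
        (\<forall>j\<in>{1..length \<tau>}. \<forall>k\<in>{1..length \<tau>}.
           \<sigma> (i j) < \<sigma> (i k) \<longleftrightarrow> \<tau> ! (j - 1) < \<tau> ! (k - 1)))"

definition avoiding_perms :: "nat \<Rightarrow> nat list \<Rightarrow> (nat \<Rightarrow> nat) set" where
  "avoiding_perms n \<tau> = {\<sigma>. \<sigma> permutes {1..n} \<and> \<not> contains_pattern n \<sigma> \<tau>}"

text \<open>Since \<open>permutes\<close> makes \<open>\<sigma>\<close> the identity off \<open>{1..n}\<close>, this extends \<open>\<sigma>\<close> by \<open>\<sigma> j = j\<close> for \<open>j > n\<close>.\<close>

definition embed_perm :: "(nat \<Rightarrow> nat) \<Rightarrow> nat \<Rightarrow> enat" where
  "embed_perm \<sigma> = (\<lambda>j\<in>{1..}. enat (\<sigma> j))"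

lemma embed_perm_in_S_ext: "\<sigma> permutes {1..n} \<Longrightarrow> embed_perm \<sigma> \<in> S_ext"
proof -
  assume *: "\<sigma> permutes {1..n}"
  have "1 \<le> \<sigma> j" if "1 \<le> j" for j
    using permutes_in_image[OF *, of j] permutes_not_in[OF *, of j] that by (cases "j \<le> n") auto
  moreover have "inj \<sigma>" using * by (rule permutes_inj)
  ultimately show ?thesis
    unfolding S_ext_def embed_perm_def by (auto simp: inj_on_def one_enat_def)
qed

definition mu :: "nat list \<Rightarrow> nat \<Rightarrow> (nat \<Rightarrow> enat) measure" where
  "mu \<tau> n = distr (uniform_count_measure (avoiding_perms n \<tau>)) (borel_of S_top) embed_perm"

subsection \<open>The limiting random variable\<close>

text \<open>
  For infinite \<open>I\<close> the \<open>n\<close>-th block (\<open>n \<ge> 1\<close>) of the concatenation is \<open>\<infinity>\<close> repeated \<open>J n\<close> times,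
  followed by the \<open>n\<close>-th smallest element of \<open>I\<close>.  For finite \<open>I\<close>, where the concatenation is not
  defined, the value is the constant function \<open>\<infinity>\<close>, so that the result lies in \<open>S_ext\<close> for every \<open>I\<close>
  not containing \<open>0\<close>.
\<close>

definition infty_concat :: "(nat \<Rightarrow> nat) \<Rightarrow> nat set \<Rightarrow> nat \<Rightarrow> enat" where
  "infty_concat J I =
     (if infinite I
      then (\<lambda>m\<in>{1..}. flat (smap (\<lambda>n. replicate (J n) \<infinity> @ [enat (enumerate I (n - 1))]) (fromN 1)) !! (m - 1))
      else (\<lambda>m\<in>{1..}. \<infinity>))"

definition partial_sum :: "(nat \<Rightarrow> nat) \<Rightarrow> nat \<Rightarrow> nat" where
  "partial_sum a n = (\<Sum>j=1..n. a j)"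

definition I1_set :: "(nat \<Rightarrow> nat) \<Rightarrow> (nat \<Rightarrow> nat) \<Rightarrow> (nat \<Rightarrow> nat) \<Rightarrow> nat set" where
  "I1_set xh y1 y2 = (\<Union>n.
     {partial_sum y1 n + partial_sum xh (partial_sum y2 n) + 1 ..
      partial_sum y1 (n + 1) + partial_sum xh (partial_sum y2 n)})"

definition I0_set :: "(nat \<Rightarrow> nat) \<Rightarrow> (nat \<Rightarrow> nat) \<Rightarrow> (nat \<Rightarrow> nat) \<Rightarrow> nat set" where
  "I0_set xh y1 y2 = (\<Union>n.
     {partial_sum y1 n + partial_sum xh (partial_sum y2 (n + 1)) + 1 ..
      partial_sum y1 (n + 1) + partial_sum xh (partial_sum y2 (n + 1))})"

definition limit_perm ::
  "(nat \<Rightarrow> 'w \<Rightarrow> nat) \<Rightarrow> (nat \<Rightarrow> 'w \<Rightarrow> nat) \<Rightarrow> (nat \<Rightarrow> 'w \<Rightarrow> nat) \<Rightarrow> (nat \<Rightarrow> 'w \<Rightarrow> nat) \<Rightarrow> ('w \<Rightarrow> nat)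
     \<Rightarrow> 'w \<Rightarrow> nat \<Rightarrow> enat" where
  "limit_perm X Xh Y1 Y2 chi \<omega> =
     (if chi \<omega> = 1
      then infty_concat (\<lambda>n. X n \<omega>) (I1_set (\<lambda>n. Xh n \<omega>) (\<lambda>n. Y1 n \<omega>) (\<lambda>n. Y2 n \<omega>))
      else infty_concat (\<lambda>n. X n \<omega>) (I0_set (\<lambda>n. Xh n \<omega>) (\<lambda>n. Y1 n \<omega>) (\<lambda>n. Y2 n \<omega>)))"

text \<open>Labels that merge the four sequences and \<open>chi\<close> into one family, to express their mutual independence.\<close>

datatype rv_index = Idx_X nat | Idx_Xh nat | Idx_Y1 nat | Idx_Y2 nat | Idx_chi

definition rv_indices :: "rv_index set" where
  "rv_indices = Idx_X ` {1..} \<union> Idx_Xh ` {1..} \<union> Idx_Y1 ` {1..} \<union> Idx_Y2 ` {1..} \<union> {Idx_chi}"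

primrec rv_family ::
  "(nat \<Rightarrow> 'w \<Rightarrow> nat) \<Rightarrow> (nat \<Rightarrow> 'w \<Rightarrow> nat) \<Rightarrow> (nat \<Rightarrow> 'w \<Rightarrow> nat) \<Rightarrow> (nat \<Rightarrow> 'w \<Rightarrow> nat) \<Rightarrow> ('w \<Rightarrow> nat)
     \<Rightarrow> rv_index \<Rightarrow> 'w \<Rightarrow> nat" where
  "rv_family X Xh Y1 Y2 chi (Idx_X n) = X n"
| "rv_family X Xh Y1 Y2 chi (Idx_Xh n) = Xh n"
| "rv_family X Xh Y1 Y2 chi (Idx_Y1 n) = Y1 n"
| "rv_family X Xh Y1 Y2 chi (Idx_Y2 n) = Y2 n"
| "rv_family X Xh Y1 Y2 chi Idx_chi = chi"

end

theory Submission
  imports Defs "HOL-Real_Asymp.Real_Asymp" "HOL-Combinatorics.Multiset_Permutations"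
begin

text \<open>
  Write \<open>p k = C\<^sub>k / (2 \<cdot> 4\<^sup>k)\<close>. The gaps between consecutive elements of \<open>I\<^sup>(\<^sup>1\<^sup>)\<close> or \<open>I\<^sup>(\<^sup>0\<^sup>)\<close>, the fair choice
  between the two being included, are IID with law \<open>p\<close>: the runs come from fair coin tosses, and
  \<open>C\<^sub>y\<close> is the sum over the compositions of \<open>y\<close> of the products of the \<open>C\<^bsub>l - 1\<^esub>\<close>, \<open>l\<close> running through
  the parts. Hence the limit lists, for each of its finite values, \<open>x\<close> infinite
  entries in front and \<open>y\<close> skipped values, with all \<open>x\<close> and \<open>y\<close> independent of law \<open>p\<close>.

  On the other side, a 213-avoiding permutation of length \<open>n\<close> that has \<open>x\<close> entries, all above \<open>y + 1\<close>,
  in front of the value \<open>y + 1\<close> consists of the \<open>x\<close> largest values, then \<open>y + 1\<close>, then the middle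
  values, then the values \<open>1, \<dots>, y\<close>, each block avoiding 213. So there are
  \<open>C\<^sub>x C\<^sub>y C\<^bsub>n - x - y - 1\<^esub>\<close> of them, a fraction tending to \<open>p x \<cdot> p y\<close>, and the middle block can be treated
  in the same way. Fatou's lemma turns these limits into the weak convergence.
\<close>

section \<open>Catalan numbers\<close>

text \<open>Upper bounds in one direction suffice. The event that the limit has initial word
  \<open>w\<close> is shown to have probability at most \<open>word_weight w\<close>; for a
  nonnegative continuous function this bounds its integral against the limit law by the limes
  inferior of its integrals against the measures on permutations. Applied to \<open>f + B\<close>
  and to \<open>B - f\<close>, this encloses the integrals of \<open>f\<close> from both sides,
  because all measures have mass 1. The combinatorial obstacle is that a finite permutation has no
  infinite entries. Values above the threshold \<open>n div 2\<close> represent them: for a fixed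
  word and large \<open>n\<close> the top blocks lie above it and the listed values do not, so the
  word can be recovered and distinct words of one length describe disjoint sets of permutations. The
  probabilistic obstacle is that the gaps address the variables through random indices. The
  variables are therefore revealed one after another, and memorylessness of the geometric law makes
  every gap \<open>y\<close> cost \<open>crit y\<close>, whatever came before.\<close>

lemma catalan_0 [simp]: "catalan 0 = 1"
  by (simp add: catalan_def)

lemma catalan_pos: "0 < catalan n"
  by (simp add: catalan_def)

lemma catalan_Suc: "(real n + 2) * catalan (Suc n) = (4 * real n + 2) * catalan n"
proof -
  have "real (Suc n) * real (Suc (2 * n) choose n) = real (Suc (2 * n)) * real (2 * n choose n)"
  proof -
    have "Suc n * (Suc (2 * n) choose n) = Suc (2 * n) * (2 * n choose n)"
      using binomial_symmetric[of n "Suc (2 * n)"] Suc_times_binomial_eq[of "2 * n" n]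
      by (simp add: mult_2 Suc_diff_le)
    then show ?thesis
      by (metis of_nat_mult)
  qed
  moreover have "2 * (n + 1) choose (n + 1) = 2 * (Suc (2 * n) choose n)"
    using binomial_symmetric[of n "Suc (2 * n)"] by (simp add: mult_2 Suc_diff_le)
  ultimately show ?thesis
    unfolding catalan_def by (simp add: field_simps)
qed

text \<open>Reflecting \<open>k\<close> to \<open>m - k\<close> shows that weighting the terms by
  \<open>k\<close> multiplies the sum by \<open>m / 2\<close>. Hence the sum with weights
  \<open>k + 1\<close> can be evaluated twice: by this symmetry, and by shifting the index and
  applying \<open>catalan_Suc\<close>. Comparing the two values gives the convolution the recurrence
  of the Catalan numbers.\<close>

lemma catalan_convolution: "(\<Sum>k\<le>n. catalan k * catalan (n - k)) = catalan (Suc n)"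
proof (induction n)
  case 0
  then show ?case using catalan_Suc[of 0] by simp
next
  case (Suc n)
  have symm: "2 * (\<Sum>k\<le>m. real k * (catalan k * catalan (m - k))) = real m * (\<Sum>k\<le>m. catalan k * catalan (m - k))" for m
  proof -
    have "(\<Sum>k\<le>m. real k * (catalan k * catalan (m - k))) = (\<Sum>k\<le>m. real (m - k) * (catalan (m - k) * catalan k))"
      by (rule sum.reindex_bij_witness[of _ "\<lambda>k. m - k" "\<lambda>k. m - k"]) auto
    then have "2 * (\<Sum>k\<le>m. real k * (catalan k * catalan (m - k)))
       = (\<Sum>k\<le>m. real k * (catalan k * catalan (m - k)) + real (m - k) * (catalan (m - k) * catalan k))"
      by (simp add: sum.distrib)
    also have "\<dots> = (\<Sum>k\<le>m. real m * (catalan k * catalan (m - k)))"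
      by (rule sum.cong) (auto simp: of_nat_diff algebra_simps)
    finally show ?thesis by (simp add: sum_distrib_left)
  qed
  let ?s = "\<lambda>m. \<Sum>k\<le>m. catalan k * catalan (m - k)"
  have "(\<Sum>k\<le>Suc n. (real k + 1) * (catalan k * catalan (Suc n - k)))
      = catalan (Suc n) + (\<Sum>k\<le>n. (real k + 2) * catalan (Suc k) * catalan (n - k))"
    by (subst sum.atMost_Suc_shift) (simp add: algebra_simps)
  also have "\<dots> = catalan (Suc n) + (\<Sum>k\<le>n. (4 * real k + 2) * catalan k * catalan (n - k))"
    by (simp add: catalan_Suc)
  also have "\<dots> = catalan (Suc n) + (2 * (2 * (\<Sum>k\<le>n. real k * (catalan k * catalan (n - k)))) + 2 * ?s n)"
    by (simp add: sum_distrib_left sum.distrib algebra_simps)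
  also have "\<dots> = (2 * real n + 3) * catalan (Suc n)"
    unfolding symm Suc.IH by (simp add: algebra_simps)
  finally have "2 * (\<Sum>k\<le>Suc n. (real k + 1) * (catalan k * catalan (Suc n - k))) = (4 * real n + 6) * catalan (Suc n)"
    by simp
  moreover have "2 * (\<Sum>k\<le>Suc n. (real k + 1) * (catalan k * catalan (Suc n - k)))
      = 2 * (\<Sum>k\<le>Suc n. real k * (catalan k * catalan (Suc n - k))) + 2 * ?s (Suc n)"
    by (simp only: distrib_right sum.distrib distrib_left mult_1)
  ultimately have "(real n + 3) * ?s (Suc n) = (4 * real n + 6) * catalan (Suc n)"
    unfolding symm by (simp add: algebra_simps)
  also have "\<dots> = (real n + 3) * catalan (Suc (Suc n))"
    using catalan_Suc[of "Suc n"] by (simp add: algebra_simps)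
  finally show ?case by simp
qed

text \<open>Telescoping \<open>s\<close> ratios, each tending to 1/4 by \<open>catalan_Suc\<close>.
  The truncation in \<open>n - s\<close> affects only \<open>n < s\<close>.\<close>

lemma catalan_ratio_tendsto: "(\<lambda>n. catalan (n - s) / catalan n) \<longlonglongrightarrow> (1/4) ^ s"
proof (induction s)
  case 0
  show ?case using catalan_pos by (simp add: less_imp_neq[symmetric])
next
  case (Suc s)
  have ratio: "catalan n / catalan (Suc n) = (real n + 2) / (4 * real n + 2)" for n
    using catalan_Suc[of n] catalan_pos[of n] catalan_pos[of "Suc n"] by (simp add: field_simps)
  have "(\<lambda>n. (real n + 2) / (4 * real n + 2)) \<longlonglongrightarrow> 1/4"
    by real_asymp
  then have "(\<lambda>n. (catalan n / catalan (Suc n)) * (catalan (n - s) / catalan n)) \<longlonglongrightarrow> 1/4 * (1/4) ^ s"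
    unfolding ratio by (intro tendsto_mult Suc.IH)
  moreover have "(catalan n / catalan (Suc n)) * (catalan (n - s) / catalan n) = catalan (Suc n - Suc s) / catalan (Suc n)" for n
    using catalan_pos[of n] by simp
  ultimately have "(\<lambda>n. catalan (Suc n - Suc s) / catalan (Suc n)) \<longlonglongrightarrow> (1/4) ^ Suc s"
    by simp
  then show ?case
    by (rule LIMSEQ_imp_Suc)
qed

text \<open>These are the terms of the Catalan generating function at its radius of convergence 1/4,
  where its value is 2; hence the 2 in the denominator.\<close>

definition crit :: "nat \<Rightarrow> real" where
  "crit k = catalan k / (2 * 4 ^ k)"

text \<open>Compositions arise as the possible lists of \<open>Xh\<close> variables that make up one
  skip of total length \<open>y\<close>; the length of the list is the value of a \<open>Y2\<close>
  variable.\<close>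

definition comps :: "nat \<Rightarrow> nat list set" where
  "comps y = {l. sum_list l = y \<and> 0 \<notin> set l}"

lemma comps_0: "comps 0 = {[]}"
proof -
  have "l = []" if "\<forall>n\<in>set l. n = 0" "0 \<notin> set l" for l :: "nat list"
    using that by (cases l) auto
  then show ?thesis by (auto simp: comps_def)
qed

lemma comps_Suc: "comps (Suc y) = (\<Union>i\<le>y. (#) (Suc i) ` comps (y - i))"
proof (intro set_eqI iffI)
  fix l assume "l \<in> comps (Suc y)"
  then obtain a l' where l: "l = a # l'" "a \<noteq> 0" "a + sum_list l' = Suc y" "0 \<notin> set l'"
    by (cases l) (auto simp: comps_def)
  then obtain i where "a = Suc i" by (cases a) auto
  with l show "l \<in> (\<Union>i\<le>y. (#) (Suc i) ` comps (y - i))"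
    by (auto simp: comps_def intro!: bexI[of _ i])
qed (auto simp: comps_def)

lemma finite_comps: "finite (comps y)"
proof (induction y rule: less_induct)
  case (less y)
  then show ?case by (cases y) (auto simp: comps_0 comps_Suc)
qed

text \<open>For the generating function C(t) this is the identity 1 / (1 - t C(t)) = C(t). Splitting
  off the first part \<open>Suc i\<close> of a composition reduces it to
  \<open>catalan_convolution\<close>.\<close>

lemma sum_comps_catalan:
  "(\<Sum>l\<in>comps y. \<Prod>i\<leftarrow>l. catalan (i - 1)) = catalan y"
proof (induction y rule: less_induct)
  case (less y)
  show ?case
  proof (cases y)
    case 0
    then show ?thesis by (simp add: comps_0)
  next
    case (Suc z)
    have "(\<Sum>l\<in>comps y. \<Prod>i\<leftarrow>l. catalan (i - 1))
        = (\<Sum>i\<le>z. \<Sum>l\<in>(#) (Suc i) ` comps (z - i). \<Prod>i\<leftarrow>l. catalan (i - 1))"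
      unfolding Suc comps_Suc by (rule sum.UNION_disjoint) (auto simp: finite_comps)
    also have "\<dots> = (\<Sum>i\<le>z. catalan i * (\<Sum>l\<in>comps (z - i). \<Prod>i\<leftarrow>l. catalan (i - 1)))"
      by (simp add: sum.reindex sum_distrib_left)
    also have "\<dots> = (\<Sum>i\<le>z. catalan i * catalan (z - i))"
      using Suc by (intro sum.cong refl) (simp add: less.IH del: One_nat_def)
    finally show ?thesis using Suc by (simp add: catalan_convolution)
  qed
qed

text \<open>One factor 1/2 goes to each part: \<open>1/2 * crit (a - 1)\<close> is
  \<open>catalan (a - 1) / 4 ^ a\<close> for \<open>a \<ge> 1\<close>, so the exponents of 4 collect
  to the sum of the list.\<close>

lemma prod_list_crit:
  "0 \<notin> set l \<Longrightarrow> (1/2) ^ length l * (\<Prod>i\<leftarrow>l. crit (i - 1)) = (\<Prod>i\<leftarrow>l. catalan (i - 1)) / 4 ^ sum_list l"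
proof (induction l)
  case (Cons a l)
  then obtain b where "a = Suc b" by (cases a) auto
  with Cons show ?case by (simp add: crit_def field_simps power_add)
qed simp

text \<open>For \<open>y \<ge> 1\<close> the left side is the probability that a geometric number of
  independent variables with the law of \<open>Xh\<close> adds up to \<open>y\<close>. The factor 2
  is cancelled later by a probability 1/2, that of ending a run or that of a value of
  \<open>chi\<close>.\<close>

lemma sum_comps_crit:
  "(\<Sum>l\<in>comps y. (1/2) ^ length l * (\<Prod>i\<leftarrow>l. crit (i - 1))) = 2 * crit y"
proof -
  have "(\<Sum>l\<in>comps y. (1/2) ^ length l * (\<Prod>i\<leftarrow>l. crit (i - 1))) = (\<Sum>l\<in>comps y. (\<Prod>i\<leftarrow>l. catalan (i - 1)) / 4 ^ y)"
  proof (rule sum.cong)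
    fix l assume "l \<in> comps y"
    then show "(1/2) ^ length l * (\<Prod>i\<leftarrow>l. crit (i - 1)) = (\<Prod>i\<leftarrow>l. catalan (i - 1)) / 4 ^ y"
      using prod_list_crit[of l] by (simp add: comps_def)
  qed simp
  also have "\<dots> = catalan y / 4 ^ y"
    by (simp only: sum_comps_catalan sum_divide_distrib[symmetric])
  finally show ?thesis by (simp add: crit_def)
qed

section \<open>Avoiders of 213 as lists\<close>

text \<open>The head is tested in the role of the 2: behind it no smaller entry may precede a larger
  one. The recursion suits concatenations of blocks; the index form in
  \<open>avoids_213_iff_nth\<close> connects it with \<open>contains_pattern\<close>.\<close>

primrec avoids_213 :: "nat list \<Rightarrow> bool" where
  "avoids_213 [] = True"
| "avoids_213 (v # l) = (avoids_213 l \<and> sorted_wrt (\<lambda>b c. \<not> (b < v \<and> v < c)) l)"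

lemma avoids_213_iff_nth:
  "avoids_213 l \<longleftrightarrow> \<not> (\<exists>i j k. i < j \<and> j < k \<and> k < length l \<and> l ! j < l ! i \<and> l ! i < l ! k)"
proof (induction l)
  case (Cons v l)
  have "(\<exists>i j k. i < j \<and> j < k \<and> k < length (v # l) \<and> (v # l) ! j < (v # l) ! i \<and> (v # l) ! i < (v # l) ! k)
    \<longleftrightarrow> (\<exists>j k. j < k \<and> k < length l \<and> l ! j < v \<and> v < l ! k)
      \<or> (\<exists>i j k. i < j \<and> j < k \<and> k < length l \<and> l ! j < l ! i \<and> l ! i < l ! k)" (is "?L \<longleftrightarrow> ?A \<or> ?B")
  proof
    assume ?L
    then obtain i j k where ijk: "i < j" "j < k" "k < length (v # l)"
      "(v # l) ! j < (v # l) ! i" "(v # l) ! i < (v # l) ! k" by blast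
    then obtain j' k' where jk: "j = Suc j'" "k = Suc k'" by (metis not_less0 old.nat.exhaust)
    show "?A \<or> ?B"
    proof (cases i)
      case 0
      with ijk jk have ?A by auto
      then show ?thesis ..
    next
      case (Suc i')
      with ijk jk have "i' < j' \<and> j' < k' \<and> k' < length l \<and> l ! j' < l ! i' \<and> l ! i' < l ! k'" by simp
      then show ?thesis by blast
    qed
  next
    assume "?A \<or> ?B"
    then show ?L
    proof
      assume ?A
      then obtain j k where "j < k" "k < length l" "l ! j < v" "v < l ! k" by blast
      then show ?L by (intro exI[of _ 0] exI[of _ "Suc j"] exI[of _ "Suc k"]) simp
    next
      assume ?B
      then obtain i j k where "i < j" "j < k" "k < length l" "l ! j < l ! i" "l ! i < l ! k" by blast
      then show ?L by (intro exI[of _ "Suc i"] exI[of _ "Suc j"] exI[of _ "Suc k"]) simp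
    qed
  qed
  then show ?case
    using Cons.IH by (auto simp: sorted_wrt_iff_nth_less)
qed simp

lemma sorted_wrt_if_all: "(\<And>x y. x \<in> set l \<Longrightarrow> y \<in> set l \<Longrightarrow> R x y) \<Longrightarrow> sorted_wrt R l"
  by (induction l) auto

text \<open>An occurrence of 213 cannot straddle the blocks: if its 2 lies in \<open>a\<close>, the
  larger 3 cannot lie in \<open>b\<close>, and the 1 stands between them.\<close>

lemma avoids_213_append:
  assumes "\<And>u v. u \<in> set a \<Longrightarrow> v \<in> set b \<Longrightarrow> v < u"
  shows "avoids_213 (a @ b) \<longleftrightarrow> avoids_213 a \<and> avoids_213 b"
  using assms
proof (induction a)
  case (Cons w a)
  have "sorted_wrt (\<lambda>x y. \<not> (x < w \<and> w < y)) b"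
    using Cons.prems by (intro sorted_wrt_if_all) (auto dest: order.asym)
  with Cons show ?case by (auto simp: sorted_wrt_append dest: order.asym)
qed simp

text \<open>At the front \<open>v\<close> can only play the 2, and nothing larger than
  \<open>v\<close> comes after something smaller.\<close>

lemma avoids_213_Cons_append:
  assumes "\<And>u. u \<in> set a \<Longrightarrow> v < u" "\<And>u. u \<in> set b \<Longrightarrow> u < v"
  shows "avoids_213 (v # a @ b) \<longleftrightarrow> avoids_213 a \<and> avoids_213 b"
proof -
  have "sorted_wrt (\<lambda>x y. \<not> (x < v \<and> v < y)) a"
    using assms by (intro sorted_wrt_if_all) (auto dest: order.asym)
  moreover have "sorted_wrt (\<lambda>x y. \<not> (x < v \<and> v < y)) b"
    using assms by (intro sorted_wrt_if_all) (auto dest: order.asym)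
  moreover have "avoids_213 (a @ b) \<longleftrightarrow> avoids_213 a \<and> avoids_213 b"
    using assms by (intro avoids_213_append) (meson order.strict_trans)
  ultimately show ?thesis
    using assms by (auto simp: sorted_wrt_append dest: order.asym)
qed

lemma sorted_wrt_split:
  assumes "sorted_wrt (\<lambda>b c. \<not> (b < v \<and> v < c)) l" "v \<notin> set l"
  shows "\<exists>a b. l = a @ b \<and> (\<forall>u\<in>set a. v < u) \<and> (\<forall>u\<in>set b. u < (v::nat))"
proof (intro exI conjI)
  show "l = takeWhile ((<) v) l @ dropWhile ((<) v) l" by simp
  show "\<forall>u\<in>set (takeWhile ((<) v) l). v < u" by (auto dest: set_takeWhileD)
  show "\<forall>u\<in>set (dropWhile ((<) v) l). u < v"
  proof (cases "dropWhile ((<) v) l")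
    case (Cons x d)
    then have "\<not> v < x" by (metis hd_dropWhile list.distinct(1) list.sel(1))
    moreover have "set (x # d) \<subseteq> set l" unfolding Cons[symmetric] by (auto dest: set_dropWhileD)
    moreover have "sorted_wrt (\<lambda>b c. \<not> (b < v \<and> v < c)) (takeWhile ((<) v) l @ x # d)"
      using assms(1) unfolding Cons[symmetric] by simp
    ultimately show ?thesis
      using assms(2) unfolding Cons by (auto simp: sorted_wrt_append not_less le_less)
  next
    case Nil
    show ?thesis unfolding Nil by simp
  qed
qed

text \<open>The offset \<open>lo\<close> keeps each block on its actual interval of values, so that
  decompositions involve no renumbering.\<close>

definition av_lists :: "nat \<Rightarrow> nat \<Rightarrow> nat list set" where
  "av_lists lo n = {l. distinct l \<and> set l = {lo<..lo + n} \<and> avoids_213 l}"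

lemma av_lists_0: "av_lists lo 0 = {[]}"
  by (auto simp: av_lists_def)

lemma length_av_lists: "l \<in> av_lists lo n \<Longrightarrow> length l = n"
  by (auto simp: av_lists_def dest!: distinct_card)

lemma finite_av_lists: "finite (av_lists lo n)"
proof (rule finite_subset)
  show "av_lists lo n \<subseteq> permutations_of_set {lo<..lo + n}"
    by (auto simp: av_lists_def permutations_of_set_def)
qed simp

text \<open>The first entry forces all larger values to stand before all smaller ones. The two parts
  are arbitrary avoiders on intervals, which is the Catalan recurrence.\<close>

lemma av_lists_Suc:
  "av_lists lo (Suc n) = (\<Union>k\<le>n. (\<lambda>(a, b). (lo + Suc k) # a @ b) ` (av_lists (lo + Suc k) (n - k) \<times> av_lists lo k))"
proof (intro set_eqI iffI)
  fix l assume l: "l \<in> av_lists lo (Suc n)"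
  then obtain v l' where v: "l = v # l'" by (cases l) (auto simp: av_lists_def)
  with l have l': "avoids_213 l'" "v \<notin> set l'" "distinct l'" "sorted_wrt (\<lambda>b c. \<not> (b < v \<and> v < c)) l'"
    and set: "insert v (set l') = {lo<..lo + Suc n}"
    by (auto simp: av_lists_def)
  obtain a b where ab: "l' = a @ b" "\<forall>u\<in>set a. v < u" "\<forall>u\<in>set b. u < v"
    using sorted_wrt_split[OF l'(4,2)] by blast
  have "lo < v" "v \<le> lo + Suc n" using set by auto
  then obtain k where k: "v = lo + Suc k" "k \<le> n"
    by (auto dest!: less_imp_Suc_add)
  have mem: "u \<in> set a \<or> u = v \<or> u \<in> set b \<longleftrightarrow> lo < u \<and> u \<le> lo + Suc n" for u
    using set ab(1) by (auto simp: set_eq_iff)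
  have "set a = {lo + Suc k<..lo + Suc k + (n - k)}"
  proof (intro set_eqI)
    fix u show "u \<in> set a \<longleftrightarrow> u \<in> {lo + Suc k<..lo + Suc k + (n - k)}"
      using mem[of u] ab(2,3) k by (cases "u \<in> set a"; cases "u \<in> set b") auto
  qed
  moreover have "set b = {lo<..lo + k}"
  proof (intro set_eqI)
    fix u show "u \<in> set b \<longleftrightarrow> u \<in> {lo<..lo + k}"
      using mem[of u] ab(2,3) k by (cases "u \<in> set a"; cases "u \<in> set b") auto
  qed
  moreover have "avoids_213 a \<and> avoids_213 b"
    using avoids_213_Cons_append[of a v b] ab l v by (auto simp: av_lists_def)
  ultimately have "a \<in> av_lists (lo + Suc k) (n - k)" "b \<in> av_lists lo k"
    using l'(3) ab(1) by (auto simp: av_lists_def)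
  then show "l \<in> (\<Union>k\<le>n. (\<lambda>(a, b). (lo + Suc k) # a @ b) ` (av_lists (lo + Suc k) (n - k) \<times> av_lists lo k))"
    using k v ab(1) by force
next
  fix l assume "l \<in> (\<Union>k\<le>n. (\<lambda>(a, b). (lo + Suc k) # a @ b) ` (av_lists (lo + Suc k) (n - k) \<times> av_lists lo k))"
  then obtain k a b where k: "k \<le> n" and l: "l = (lo + Suc k) # a @ b"
    and ab: "a \<in> av_lists (lo + Suc k) (n - k)" "b \<in> av_lists lo k" by auto
  have "avoids_213 l \<longleftrightarrow> avoids_213 a \<and> avoids_213 b"
    unfolding l by (rule avoids_213_Cons_append) (use ab in \<open>auto simp: av_lists_def\<close>)
  then show "l \<in> av_lists lo (Suc n)"
    using ab k unfolding l av_lists_def by auto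
qed

lemma card_av_lists: "real (card (av_lists lo n)) = catalan n"
proof (induction n arbitrary: lo rule: less_induct)
  case (less n)
  show ?case
  proof (cases n)
    case 0
    then show ?thesis by (simp add: av_lists_0)
  next
    case (Suc m)
    let ?S = "\<lambda>k. av_lists (lo + Suc k) (m - k) \<times> av_lists lo k"
    let ?g = "\<lambda>k. (\<lambda>(a, b). (lo + Suc k) # a @ b)"
    have "card (av_lists lo n) = (\<Sum>k\<le>m. card (?g k ` ?S k))"
      unfolding Suc av_lists_Suc
      by (rule card_UN_disjoint) (auto simp: finite_av_lists)
    also have "\<dots> = (\<Sum>k\<le>m. card (?S k))"
    proof (intro sum.cong refl card_image inj_onI)
      fix k p q assume "p \<in> ?S k" "q \<in> ?S k" "?g k p = ?g k q"
      then show "p = q"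
        using length_av_lists[of "fst p"] length_av_lists[of "fst q"] by (cases p, cases q) auto
    qed
    finally have "real (card (av_lists lo n)) = (\<Sum>k\<le>m. catalan (m - k) * catalan k)"
      using Suc by (simp add: less.IH card_cartesian_product)
    then show ?thesis
      using Suc by (simp add: catalan_convolution[symmetric] mult.commute)
  qed
qed

text \<open>A word lists, for each finite value of the limit, the number of infinite entries in front
  of it and the number of values it skips.\<close>

fun listing :: "nat \<Rightarrow> (nat \<times> nat) list \<Rightarrow> enat list" where
  "listing v [] = []"
| "listing v ((x, y) # w) = replicate x \<infinity> @ enat (v + y + 1) # listing (v + y + 1) w"

text \<open>Each pair uses up \<open>x\<close> values at the top, \<open>y\<close> at the bottom and
  the listed value itself; the values left over form the innermost block of a finite
  permutation.\<close>

definition word_size :: "(nat \<times> nat) list \<Rightarrow> nat" where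
  "word_size w = (\<Sum>(x, y)\<leftarrow>w. x + y + 1)"

definition word_weight :: "(nat \<times> nat) list \<Rightarrow> real" where
  "word_weight w = (\<Prod>(x, y)\<leftarrow>w. crit x * crit y)"

text \<open>A finite permutation imitates an infinite entry by a value above the threshold
  \<open>K\<close>.\<close>

definition entry_match :: "nat \<Rightarrow> enat \<Rightarrow> enat \<Rightarrow> bool" where
  "entry_match K u e \<longleftrightarrow> (if e = \<infinity> then enat K < u else u = e)"

definition matches :: "nat \<Rightarrow> enat list \<Rightarrow> enat list \<Rightarrow> bool" where
  "matches K l L \<longleftrightarrow> (\<exists>l1 l2. l = l1 @ l2 \<and> list_all2 (entry_match K) l1 L)"

text \<open>Only \<open>b\<close> is subject to the rest of the word; the skipped values
  \<open>c\<close> come last, behind everything the word prescribes. Subtraction truncates, so the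
  sets have their intended meaning for \<open>word_size w \<le> n\<close>.\<close>

fun word_lists :: "nat \<Rightarrow> nat \<Rightarrow> (nat \<times> nat) list \<Rightarrow> nat list set" where
  "word_lists lo n [] = av_lists lo n"
| "word_lists lo n ((x, y) # w) = (\<lambda>(a, b, c). a @ (lo + y + 1) # b @ c) `
     (av_lists (lo + (n - x)) x \<times> word_lists (lo + y + 1) (n - (x + y + 1)) w \<times> av_lists lo y)"

lemma word_lists_subset: "word_size w \<le> n \<Longrightarrow> word_lists lo n w \<subseteq> av_lists lo n"
proof (induction w arbitrary: lo n)
  case (Cons p w)
  obtain x y where p: "p = (x, y)" by (cases p)
  have size: "x + y + 1 \<le> n" "word_size w \<le> n - (x + y + 1)"
    using Cons.prems by (auto simp: p word_size_def)
  show ?case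
  proof
    fix l assume "l \<in> word_lists lo n (p # w)"
    then obtain a b c where l: "l = a @ (lo + y + 1) # b @ c" and a: "a \<in> av_lists (lo + (n - x)) x"
      and b: "b \<in> av_lists (lo + y + 1) (n - (x + y + 1))" and c: "c \<in> av_lists lo y"
      using Cons.IH[OF size(2), of "lo + y + 1"] by (auto simp: p)
    have "avoids_213 ((lo + y + 1) # b @ c) \<longleftrightarrow> avoids_213 b \<and> avoids_213 c"
      by (rule avoids_213_Cons_append) (use b c in \<open>auto simp: av_lists_def\<close>)
    moreover have "avoids_213 l \<longleftrightarrow> avoids_213 a \<and> avoids_213 ((lo + y + 1) # b @ c)"
      unfolding l by (rule avoids_213_append) (use a b c size in \<open>auto simp: av_lists_def\<close>)
    ultimately have "avoids_213 l" using a b c by (simp add: av_lists_def)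
    moreover have "distinct l" "set l = {lo<..lo + n}"
      using a b c size unfolding l by (auto simp: av_lists_def)
    ultimately show "l \<in> av_lists lo n" by (simp add: av_lists_def)
  qed
qed simp

lemma card_word_lists:
  "word_size w \<le> n \<Longrightarrow>
     real (card (word_lists lo n w)) = (\<Prod>(x, y)\<leftarrow>w. catalan x * catalan y) * catalan (n - word_size w)"
proof (induction w arbitrary: lo n)
  case Nil
  then show ?case by (simp add: card_av_lists word_size_def)
next
  case (Cons p w)
  obtain x y where p: "p = (x, y)" by (cases p)
  have size: "x + y + 1 \<le> n" "word_size w \<le> n - (x + y + 1)"
    and ws: "word_size (p # w) = x + y + 1 + word_size w"
    using Cons.prems by (auto simp: p word_size_def)
  \<comment> \<open>The lengths of the blocks are determined by \<open>n\<close> and the word, so a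
    concatenation splits in only one way.\<close>
  have len: "length b = n - (x + y + 1)" if "b \<in> word_lists (lo + y + 1) (n - (x + y + 1)) w" for b
    using word_lists_subset[OF size(2)] that by (blast intro: length_av_lists)
  have "card (word_lists lo n (p # w)) = card (av_lists (lo + (n - x)) x \<times> word_lists (lo + y + 1) (n - (x + y + 1)) w \<times> av_lists lo y)"
    unfolding p word_lists.simps
  proof (intro card_image inj_onI)
    fix t t' assume t: "t \<in> av_lists (lo + (n - x)) x \<times> word_lists (lo + y + 1) (n - (x + y + 1)) w \<times> av_lists lo y"
      "t' \<in> av_lists (lo + (n - x)) x \<times> word_lists (lo + y + 1) (n - (x + y + 1)) w \<times> av_lists lo y"
      and eq: "(\<lambda>(a, b, c). a @ (lo + y + 1) # b @ c) t = (\<lambda>(a, b, c). a @ (lo + y + 1) # b @ c) t'"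
    obtain a b c a' b' c' where tt: "t = (a, b, c)" "t' = (a', b', c')" by (cases t, cases t') auto
    have "length a = length a'" "length b = length b'"
      using t len[of b] len[of b'] length_av_lists[of a] length_av_lists[of a'] by (auto simp: tt)
    then show "t = t'" using eq by (simp add: tt)
  qed
  then show ?case
    using Cons.IH[OF size(2), of "lo + y + 1"] unfolding ws
    by (simp add: card_cartesian_product card_av_lists p algebra_simps)
qed

text \<open>The top blocks of all pairs together hold the \<open>sum_list (map fst w)\<close>
  largest values, whence the bound on \<open>K\<close>. It passes to the inner block because the
  interval of that block ends at \<open>lo + n - x\<close>.\<close>

lemma word_lists_matches:
  "word_size w \<le> n \<Longrightarrow> l \<in> word_lists lo n w \<Longrightarrow> K \<le> lo + n - sum_list (map fst w) \<Longrightarrow>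
     matches K (map enat l) (listing lo w)"
proof (induction w arbitrary: lo n l)
  case Nil
  then show ?case by (auto simp: matches_def)
next
  case (Cons p w)
  obtain x y where p: "p = (x, y)" by (cases p)
  have size: "x + y + 1 \<le> n" "word_size w \<le> n - (x + y + 1)"
    using Cons.prems by (auto simp: p word_size_def)
  obtain a b c where l: "l = a @ (lo + y + 1) # b @ c" and a: "a \<in> av_lists (lo + (n - x)) x"
    and b: "b \<in> word_lists (lo + y + 1) (n - (x + y + 1)) w"
    using Cons.prems by (auto simp: p)
  have "K \<le> (lo + y + 1) + (n - (x + y + 1)) - sum_list (map fst w)"
    using Cons.prems(3) size by (simp add: p)
  from Cons.IH[OF size(2) b this] obtain b1 b2 where
    b12: "map enat b = b1 @ b2" "list_all2 (entry_match K) b1 (listing (lo + y + 1) w)"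
    by (auto simp: matches_def)
  have "list_all2 (entry_match K) (map enat a) (replicate x \<infinity>)"
    using a length_av_lists[OF a] Cons.prems(3) size
    by (auto simp: list_all2_conv_all_nth entry_match_def av_lists_def p dest!: nth_mem)
  then have "list_all2 (entry_match K) (map enat a @ enat (lo + y + 1) # b1) (listing lo (p # w))"
    using b12(2) unfolding p listing.simps by (intro list_all2_appendI) (auto simp: entry_match_def)
  then show ?case
    unfolding matches_def using b12(1)
    by (intro exI[of _ "map enat a @ enat (lo + y + 1) # b1"] exI[of _ "b2 @ map enat c"]) (simp add: l)
qed

text \<open>As \<open>b \<le> K\<close>, the first entry not above \<open>K\<close> is
  \<open>b\<close>. The block in front of it is thus read off from the sequence alone, whatever
  follows.\<close>

lemma takeWhile_matches:
  assumes "list_all2 (entry_match K) l1 (replicate x \<infinity> @ enat b # L)" "b \<le> K"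
  shows "\<exists>a l1'. l1 = a @ enat b # l1' \<and> length a = x \<and> list_all2 (entry_match K) l1' L
           \<and> takeWhile ((<) (enat K)) (l1 @ l2) = a"
proof -
  from assms obtain a l1' where *: "l1 = a @ enat b # l1'" "list_all2 (entry_match K) a (replicate x \<infinity>)"
    "list_all2 (entry_match K) l1' L"
    by (auto simp: list_all2_append2 list_all2_Cons2 entry_match_def)
  then have "\<forall>u\<in>set a. enat K < u" "length a = x"
    by (auto simp: list_all2_conv_all_nth entry_match_def in_set_conv_nth)
  with * assms(2) show ?thesis
    by (intro exI[of _ a] exI[of _ l1']) (auto simp: takeWhile_append)
qed

text \<open>A sequence is parsed in only one way: the number of entries before the first one that is
  at most \<open>K\<close> gives \<open>x\<close>, that entry gives \<open>y\<close>, and so on. The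
  last two hypotheses keep all finite values listed by either word at most \<open>K\<close>.\<close>

lemma matches_listing_unique:
  assumes "matches K l (listing v w)" "matches K l (listing v w')" "length w = length w'"
    "v + (\<Sum>(x, y)\<leftarrow>w. y + 1) \<le> K" "v + (\<Sum>(x, y)\<leftarrow>w'. y + 1) \<le> K"
  shows "w = w'"
  using assms
proof (induction w arbitrary: v w' l)
  case (Cons p w)
  obtain x y where p: "p = (x, y)" by (cases p)
  obtain x' y' w'' where w': "w' = (x', y') # w''" using Cons.prems(3) by (cases w') auto
  obtain l1 l2 where l: "l = l1 @ l2" "list_all2 (entry_match K) l1 (replicate x \<infinity> @ enat (v + y + 1) # listing (v + y + 1) w)"
    using Cons.prems(1) by (auto simp: matches_def p)
  obtain l1' l2' where l': "l = l1' @ l2'" "list_all2 (entry_match K) l1' (replicate x' \<infinity> @ enat (v + y' + 1) # listing (v + y' + 1) w'')"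
    using Cons.prems(2) by (auto simp: matches_def w')
  have "v + y + 1 \<le> K" "v + y' + 1 \<le> K" using Cons.prems(4,5) by (auto simp: p w')
  note K = this
  obtain a b where
    1: "l1 = a @ enat (v + y + 1) # b" "length a = x" "list_all2 (entry_match K) b (listing (v + y + 1) w)"
       "takeWhile ((<) (enat K)) l = a"
    using takeWhile_matches[OF l(2) K(1), of l2] unfolding l(1) by blast
  obtain a' b' where
    2: "l1' = a' @ enat (v + y' + 1) # b'" "length a' = x'" "list_all2 (entry_match K) b' (listing (v + y' + 1) w'')"
       "takeWhile ((<) (enat K)) l = a'"
    using takeWhile_matches[OF l'(2) K(2), of l2'] unfolding l'(1) by blast
  have "a = a'" using 1 2 by simp
  then have "x = x'" and y: "y = y'" and bb: "b @ l2 = b' @ l2'"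
    using 1 2 l(1) l'(1) by auto
  have "w = w''"
  proof (rule Cons.IH)
    show "matches K (b @ l2) (listing (v + y + 1) w)" using 1 by (auto simp: matches_def)
    show "matches K (b @ l2) (listing (v + y + 1) w'')" unfolding bb y using 2 by (auto simp: matches_def)
  qed (use Cons.prems y in \<open>auto simp: p w'\<close>)
  then show ?case using \<open>x = x'\<close> y by (simp add: p w')
qed simp

section \<open>Counting avoiders with a prescribed word\<close>

declare upt_Suc [simp del]

lemma contains_213_iff:
  "contains_pattern n \<sigma> [2, 1, 3] \<longleftrightarrow> (\<exists>i j k. 1 \<le> i \<and> i < j \<and> j < k \<and> k \<le> n \<and> \<sigma> j < \<sigma> i \<and> \<sigma> i < \<sigma> k)"
proof
  have set3: "{1..length [2, 1, 3::nat]} = {1, 2, 3}" by auto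
  {
    assume "contains_pattern n \<sigma> [2, 1, 3]"
    then obtain i where i: "strict_mono_on {1, 2, 3} i" "i ` {1, 2, 3} \<subseteq> {1..n}"
      and \<sigma>: "\<forall>j\<in>{1, 2, 3}. \<forall>k\<in>{1, 2, 3}. \<sigma> (i j) < \<sigma> (i k) \<longleftrightarrow> [2, 1, 3::nat] ! (j - 1) < [2, 1, 3] ! (k - 1)"
      unfolding contains_pattern_def set3 by blast
    have "i 1 < i 2" "i 2 < i 3" using i(1) by (auto simp: strict_mono_on_def)
    moreover have "\<sigma> (i 2) < \<sigma> (i 1)" "\<sigma> (i 1) < \<sigma> (i 3)"
      using \<sigma> by (auto simp: numeral_eq_Suc)
    moreover have "1 \<le> i 1" "i 3 \<le> n" using i(2) by auto
    ultimately show "\<exists>i j k. 1 \<le> i \<and> i < j \<and> j < k \<and> k \<le> n \<and> \<sigma> j < \<sigma> i \<and> \<sigma> i < \<sigma> k" by blast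
  }
  assume "\<exists>i j k. 1 \<le> i \<and> i < j \<and> j < k \<and> k \<le> n \<and> \<sigma> j < \<sigma> i \<and> \<sigma> i < \<sigma> k"
  then obtain a b c where abc: "1 \<le> a" "a < b" "b < c" "c \<le> n" "\<sigma> b < \<sigma> a" "\<sigma> a < \<sigma> c" by blast
  let ?i = "\<lambda>t::nat. if t = 1 then a else if t = 2 then b else c"
  show "contains_pattern n \<sigma> [2, 1, 3]"
    unfolding contains_pattern_def set3
  proof (intro exI[of _ ?i] conjI)
    show "strict_mono_on {1, 2, 3} ?i"
      using abc by (auto simp: strict_mono_on_def)
    show "?i ` {1, 2, 3} \<subseteq> {1..n}" using abc by auto
    show "\<forall>j\<in>{1, 2, 3}. \<forall>k\<in>{1, 2, 3}. \<sigma> (?i j) < \<sigma> (?i k) \<longleftrightarrow> [2, 1, 3::nat] ! (j - 1) < [2, 1, 3] ! (k - 1)"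
      using abc by (auto simp: numeral_eq_Suc)
  qed
qed

lemma avoids_213_map_iff:
  "avoids_213 (map \<sigma> [1..<Suc n]) \<longleftrightarrow> \<not> contains_pattern n \<sigma> [2, 1, 3]"
proof -
  have "(\<exists>i j k. i < j \<and> j < k \<and> k < n \<and> \<sigma> (Suc j) < \<sigma> (Suc i) \<and> \<sigma> (Suc i) < \<sigma> (Suc k))
    \<longleftrightarrow> (\<exists>i j k. 1 \<le> i \<and> i < j \<and> j < k \<and> k \<le> n \<and> \<sigma> j < \<sigma> i \<and> \<sigma> i < \<sigma> k)" (is "?L \<longleftrightarrow> ?R")
  proof
    assume ?L
    then obtain i j k where "i < j" "j < k" "k < n" "\<sigma> (Suc j) < \<sigma> (Suc i)" "\<sigma> (Suc i) < \<sigma> (Suc k)" by blast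
    then show ?R by (intro exI[of _ "Suc i"] exI[of _ "Suc j"] exI[of _ "Suc k"]) simp
  next
    assume ?R
    then obtain i j k where "1 \<le> i" "i < j" "j < k" "k \<le> n" "\<sigma> j < \<sigma> i" "\<sigma> i < \<sigma> k" by blast
    then show ?L by (intro exI[of _ "i - 1"] exI[of _ "j - 1"] exI[of _ "k - 1"]) auto
  qed
  moreover have "avoids_213 (map \<sigma> [1..<Suc n]) \<longleftrightarrow>
      \<not> (\<exists>i j k. i < j \<and> j < k \<and> k < n \<and> \<sigma> (Suc j) < \<sigma> (Suc i) \<and> \<sigma> (Suc i) < \<sigma> (Suc k))"
    unfolding avoids_213_iff_nth by (simp cong: conj_cong)
  ultimately show ?thesis unfolding contains_213_iff by blast
qed

lemma bij_betw_avoiding_perms: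
  "bij_betw (\<lambda>\<sigma>. map \<sigma> [1..<Suc n]) (avoiding_perms n [2, 1, 3]) (av_lists 0 n)"
  unfolding bij_betw_def
proof
  show "inj_on (\<lambda>\<sigma>. map \<sigma> [1..<Suc n]) (avoiding_perms n [2, 1, 3])"
  proof (rule inj_onI)
    fix \<sigma> \<rho> assume *: "\<sigma> \<in> avoiding_perms n [2, 1, 3]" "\<rho> \<in> avoiding_perms n [2, 1, 3]"
      "map \<sigma> [1..<Suc n] = map \<rho> [1..<Suc n]"
    show "\<sigma> = \<rho>"
    proof
      fix j
      show "\<sigma> j = \<rho> j"
      proof (cases "j \<in> {1..n}")
        case True
        then have "j \<in> set [1..<Suc n]" by auto
        with *(3) show ?thesis by (meson map_eq_conv)
      next
        case False
        then show ?thesis using * by (auto simp: avoiding_perms_def permutes_not_in)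
      qed
    qed
  qed
  show "(\<lambda>\<sigma>. map \<sigma> [1..<Suc n]) ` avoiding_perms n [2, 1, 3] = av_lists 0 n"
  proof (intro set_eqI iffI)
    fix l assume "l \<in> (\<lambda>\<sigma>. map \<sigma> [1..<Suc n]) ` avoiding_perms n [2, 1, 3]"
    then obtain \<sigma> where l: "l = map \<sigma> [1..<Suc n]" and \<sigma>: "\<sigma> permutes {1..n}" "\<not> contains_pattern n \<sigma> [2, 1, 3]"
      by (auto simp: avoiding_perms_def)
    have "distinct l" unfolding l using permutes_inj_on[OF \<sigma>(1)] by (simp add: distinct_map)
    moreover have "set l = {0<..0 + n}"
      unfolding l using permutes_image[OF \<sigma>(1)] by (auto simp: atLeastLessThanSuc_atLeastAtMost)
    ultimately show "l \<in> av_lists 0 n"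
      using \<sigma>(2) avoids_213_map_iff[of \<sigma> n] unfolding av_lists_def l by simp
  next
    fix l assume l: "l \<in> av_lists 0 n"
    then have len: "length l = n" by (rule length_av_lists)
    define \<sigma> where "\<sigma> j = (if j \<in> {1..n} then l ! (j - 1) else j)" for j
    have map: "map \<sigma> [1..<Suc n] = l"
      by (intro nth_equalityI) (auto simp: len \<sigma>_def)
    have set: "set [1..<Suc n] = {1..n}" by auto
    have "distinct (map \<sigma> [1..<Suc n])" "set (map \<sigma> [1..<Suc n]) = {1..n}"
      unfolding map using l by (simp_all add: av_lists_def atLeastSucAtMost_greaterThanAtMost)
    then have "inj_on \<sigma> {1..n}" "\<sigma> ` {1..n} = {1..n}"
      unfolding distinct_map set_map set by simp_all
    then have "bij_betw \<sigma> {1..n} {1..n}"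
      by (rule bij_betw_imageI)
    then have "\<sigma> permutes {1..n}"
      by (rule bij_imp_permutes) (simp only: \<sigma>_def if_False)
    moreover have "\<not> contains_pattern n \<sigma> [2, 1, 3]"
      using l avoids_213_map_iff[of \<sigma> n] unfolding map by (simp add: av_lists_def)
    ultimately show "l \<in> (\<lambda>\<sigma>. map \<sigma> [1..<Suc n]) ` avoiding_perms n [2, 1, 3]"
      by (intro image_eqI[of _ _ \<sigma>]) (simp_all only: map avoiding_perms_def mem_Collect_eq simp_thms)
  qed
qed

lemma finite_avoiding_perms: "finite (avoiding_perms n \<tau>)"
  by (rule finite_subset[OF _ finite_permutations[of "{1..n}"]]) (auto simp: avoiding_perms_def)

lemma card_avoiding_perms: "real (card (avoiding_perms n [2, 1, 3])) = catalan n"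
  using bij_betw_same_card[OF bij_betw_avoiding_perms] card_av_lists by metis

lemma avoiding_perms_nonempty: "avoiding_perms n [2, 1, 3] \<noteq> {}"
  using card_avoiding_perms[of n] catalan_pos[of n] by auto

section \<open>Borel sets of the space and integrals against \<open>mu\<close>\<close>

lemma space_borel_of: "space (borel_of X) = topspace X"
  unfolding borel_of_def by (rule space_measure_of) (auto dest: openin_subset)

lemma sets_borel_of: "sets (borel_of X) = sigma_sets (topspace X) {U. openin X U}"
  unfolding borel_of_def by (rule sets_measure_of) (auto dest: openin_subset)

lemma topspace_S_top [simp]: "topspace S_top = S_ext"
  using Metric_space.topspace_mtopology[OF Metric_space_S_ext] .

lemma space_borel_S_top [simp]: "space (borel_of S_top) = S_ext"
  by (simp add: space_borel_of)

lemma embed_perm_measurable: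
  "embed_perm \<in> measurable (uniform_count_measure (avoiding_perms n \<tau>)) (borel_of S_top)"
proof -
  have "embed_perm \<in> measurable (count_space (avoiding_perms n \<tau>)) (borel_of S_top)"
    by (auto simp: avoiding_perms_def intro: embed_perm_in_S_ext)
  then show ?thesis
    by (subst measurable_cong_sets[OF _ refl, of _ "count_space (avoiding_perms n \<tau>)"])
      (simp_all add: sets_uniform_count_measure)
qed

lemma sets_mu: "sets (mu \<tau> n) = sets (borel_of S_top)"
  by (simp add: mu_def)

lemma prob_space_mu: "prob_space (mu [2, 1, 3] n)"
  unfolding mu_def
  by (intro prob_space.prob_space_distr prob_space_uniform_count_measure embed_perm_measurable
      finite_avoiding_perms avoiding_perms_nonempty)

lemma nn_integral_mu:
  assumes "F \<in> borel_measurable (borel_of S_top)"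
  shows "(\<integral>\<^sup>+x. F x \<partial>mu [2, 1, 3] n)
    = (\<Sum>\<sigma>\<in>avoiding_perms n [2, 1, 3]. F (embed_perm \<sigma>) * ennreal (1 / catalan n))"
  unfolding mu_def
  by (subst nn_integral_distr[OF embed_perm_measurable])
     (simp add: assms, simp add: uniform_count_measure_def nn_integral_point_measure_finite finite_avoiding_perms
       card_avoiding_perms mult.commute del: One_nat_def)

text \<open>Acts as a shrinking neighbourhood of a limit point with initial word \<open>w\<close>:
  finite entries are prescribed exactly, infinite ones only as values above \<open>r\<close>. In the
  integral estimates \<open>r\<close> is also the length of \<open>w\<close>.\<close>

definition word_cylinder :: "nat \<Rightarrow> (nat \<times> nat) list \<Rightarrow> (nat \<Rightarrow> enat) set" where
  "word_cylinder r w = {\<rho> \<in> S_ext. list_all2 (entry_match r) (map \<rho> [1..<Suc (length (listing 0 w))]) (listing 0 w)}"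

lemma word_size_conv: "word_size w = sum_list (map fst w) + (\<Sum>(x, y)\<leftarrow>w. y + 1)"
  by (induction w) (auto simp: word_size_def)

lemma map_upt_prefix:
  assumes "map f [1..<Suc n] = l1 @ l2"
  shows "map f [1..<Suc (length l1)] = l1"
proof -
  have "length l1 \<le> n" using arg_cong[OF assms, of length] by simp
  have "l1 = take (length l1) (map f [1..<Suc n])" unfolding assms by simp
  also have "\<dots> = map f [1..<Suc (length l1)]"
    using \<open>length l1 \<le> n\<close> by (simp add: take_map take_upt)
  finally show ?thesis by simp
qed

lemma embed_perm_in_word_cylinder:
  assumes \<sigma>: "\<sigma> \<in> avoiding_perms n \<tau>" and m: "matches K (map enat (map \<sigma> [1..<Suc n])) (listing 0 w)" and "r \<le> K"
  shows "embed_perm \<sigma> \<in> word_cylinder r w"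
proof -
  obtain l1 l2 where l: "map enat (map \<sigma> [1..<Suc n]) = l1 @ l2" "list_all2 (entry_match K) l1 (listing 0 w)"
    using m by (auto simp: matches_def)
  have "map (embed_perm \<sigma>) [1..<Suc n] = l1 @ l2"
    unfolding l(1)[symmetric] by (simp add: embed_perm_def)
  then have "map (embed_perm \<sigma>) [1..<Suc (length l1)] = l1" by (rule map_upt_prefix)
  moreover have "list_all2 (entry_match r) l1 (listing 0 w)"
    using l(2) by (rule list_all2_mono) (use \<open>r \<le> K\<close> in \<open>auto simp: entry_match_def split: if_splits intro: le_less_trans[of _ "enat K"]\<close>)
  moreover have "length l1 = length (listing 0 w)" using l(2) by (rule list_all2_lengthD)
  moreover have "embed_perm \<sigma> \<in> S_ext" using \<sigma> embed_perm_in_S_ext by (auto simp: avoiding_perms_def)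
  ultimately show ?thesis by (simp add: word_cylinder_def)
qed

definition word_perms :: "nat \<Rightarrow> (nat \<times> nat) list \<Rightarrow> (nat \<Rightarrow> nat) set" where
  "word_perms n w = {\<sigma> \<in> avoiding_perms n [2, 1, 3]. map \<sigma> [1..<Suc n] \<in> word_lists 0 n w}"

lemma card_word_perms:
  assumes "word_size w \<le> n"
  shows "real (card (word_perms n w)) = (\<Prod>(x, y)\<leftarrow>w. catalan x * catalan y) * catalan (n - word_size w)"
proof -
  have "bij_betw (\<lambda>\<sigma>. map \<sigma> [1..<Suc n]) (word_perms n w) (word_lists 0 n w)"
  proof (rule bij_betw_subset[OF bij_betw_avoiding_perms])
    have "word_lists 0 n w \<subseteq> (\<lambda>\<sigma>. map \<sigma> [1..<Suc n]) ` avoiding_perms n [2, 1, 3]"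
      unfolding bij_betw_imp_surj_on[OF bij_betw_avoiding_perms] by (rule word_lists_subset[OF assms])
    then show "(\<lambda>\<sigma>. map \<sigma> [1..<Suc n]) ` word_perms n w = word_lists 0 n w"
      unfolding word_perms_def by blast
  qed (auto simp: word_perms_def)
  from bij_betw_same_card[OF this] show ?thesis using card_word_lists[OF assms, of 0] by simp
qed

text \<open>The two factors 1/2 in \<open>crit x * crit y\<close> supply the 1/4 that belongs to the
  listed value, so every value counted by \<open>word_size\<close> has its own 1/4.\<close>

lemma word_weight_conv:
  "word_weight w = (\<Prod>(x, y)\<leftarrow>w. catalan x * catalan y) * (1/4) ^ word_size w"
proof (induction w)
  case (Cons p w)
  obtain x y where p: "p = (x, y)" by (cases p)
  have "crit x * crit y = catalan x * catalan y * (1/4) ^ (x + y + 1)"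
    by (simp add: crit_def power_add power_divide)
  with Cons.IH show ?case
    by (simp add: p word_weight_def word_size_def power_add)
qed (simp add: word_weight_def word_size_def)

lemma word_perms_density:
  "(\<lambda>n. real (card (word_perms n w)) / catalan n) \<longlonglongrightarrow> word_weight w"
proof -
  have "(\<lambda>n. (\<Prod>(x, y)\<leftarrow>w. catalan x * catalan y) * (catalan (n - word_size w) / catalan n)) \<longlonglongrightarrow> word_weight w"
    unfolding word_weight_conv by (intro tendsto_mult tendsto_const catalan_ratio_tendsto)
  then show ?thesis
    by (rule Lim_transform_eventually)
      (auto intro!: eventually_sequentiallyI[of "word_size w"] simp: card_word_perms)
qed

text \<open>With \<open>word_size\<close> at most \<open>n div 2\<close>, the listed values are at
  most \<open>n div 2\<close> while the entries of the top blocks exceed \<open>n - n div 2\<close>.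
  So \<open>n div 2\<close> separates them, and the permutation determines its word of given
  length.\<close>

lemma word_perms_disjoint:
  assumes "\<sigma> \<in> word_perms n w" "\<sigma> \<in> word_perms n w'" "length w = length w'"
    "word_size w \<le> n div 2" "word_size w' \<le> n div 2"
  shows "w = w'"
proof (rule matches_listing_unique[OF _ _ assms(3)])
  show "matches (n div 2) (map enat (map \<sigma> [1..<Suc n])) (listing 0 w)"
    using assms by (intro word_lists_matches[where n = n]) (auto simp: word_perms_def word_size_conv)
  show "matches (n div 2) (map enat (map \<sigma> [1..<Suc n])) (listing 0 w')"
    using assms by (intro word_lists_matches[where n = n]) (auto simp: word_perms_def word_size_conv)
qed (use assms(4,5) in \<open>auto simp: word_size_conv\<close>)

lemma word_perms_in_word_cylinder:
  assumes "\<sigma> \<in> word_perms n w" "word_size w \<le> n div 2" "r \<le> n div 2"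
  shows "embed_perm \<sigma> \<in> word_cylinder r w"
proof (rule embed_perm_in_word_cylinder[OF _ _ assms(3)])
  show "\<sigma> \<in> avoiding_perms n [2, 1, 3]" using assms by (simp add: word_perms_def)
  show "matches (n div 2) (map enat (map \<sigma> [1..<Suc n])) (listing 0 w)"
    using assms by (intro word_lists_matches[where n = n]) (auto simp: word_perms_def word_size_conv)
qed

text \<open>For fixed \<open>n\<close> an avoider belongs to at most one admissible word, so the
  fractions of the words, summed against \<open>G\<close>, stay below the integral of
  \<open>F\<close>. Fatou's lemma for the counting measure on words then lets \<open>n\<close> tend
  to infinity, using \<open>word_perms_density\<close> for each word separately.\<close>

lemma word_sum_le_liminf_mu:
  fixes F :: "(nat \<Rightarrow> enat) \<Rightarrow> ennreal" and G :: "(nat \<times> nat) list \<Rightarrow> ennreal"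
  assumes F: "F \<in> borel_measurable (borel_of S_top)"
    and G: "\<And>w \<rho>. \<rho> \<in> word_cylinder r w \<Longrightarrow> G w \<le> F \<rho>" and fin: "\<And>w. G w < \<top>"
  shows "(\<integral>\<^sup>+w. ennreal (word_weight w) * G w \<partial>count_space {w. length w = r})
    \<le> liminf (\<lambda>n. \<integral>\<^sup>+x. F x \<partial>mu [2, 1, 3] n)"
proof -
  let ?W = "count_space {w::(nat \<times> nat) list. length w = r}"
  let ?A = "\<lambda>n. avoiding_perms n [2, 1, 3]"
  \<comment> \<open>Disjointness and membership in the cylinder are available only below
    \<open>n div 2\<close>; other words get the term 0. Each fixed word is admissible for all large
    \<open>n\<close>.\<close>
  define ok where "ok n w \<longleftrightarrow> r \<le> n div 2 \<and> word_size w \<le> n div 2" for n w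
  define a where "a n w = (if ok n w then ennreal (real (card (word_perms n w)) / catalan n) * G w else 0)" for n w
  have lim: "(\<lambda>n. a n w) \<longlonglongrightarrow> ennreal (word_weight w) * G w" for w
  proof -
    have "(\<lambda>n. ennreal (real (card (word_perms n w)) / catalan n) * G w) \<longlonglongrightarrow> ennreal (word_weight w) * G w"
      by (intro tendsto_mult_ennreal tendsto_const tendsto_ennrealI word_perms_density) (use fin[of w] in auto)
    moreover have "eventually (\<lambda>n. ennreal (real (card (word_perms n w)) / catalan n) * G w = a n w) sequentially"
      using eventually_ge_at_top[of "2 * (r + word_size w)"]
      by eventually_elim (auto simp: a_def ok_def)
    ultimately show ?thesis by (rule Lim_transform_eventually)
  qed
  have le: "(\<integral>\<^sup>+w. a n w \<partial>?W) \<le> (\<integral>\<^sup>+x. F x \<partial>mu [2, 1, 3] n)" for n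
  proof -
    have a: "a n w = (\<Sum>\<sigma>\<in>?A n. indicator (word_perms n w) \<sigma> * (if ok n w then G w else 0) * ennreal (1 / catalan n))" for w
    proof -
      have "(\<Sum>\<sigma>\<in>?A n. indicator (word_perms n w) \<sigma> * (if ok n w then G w else 0) * ennreal (1 / catalan n))
          = (\<Sum>\<sigma>\<in>?A n. indicator (word_perms n w) \<sigma>) * (if ok n w then G w else 0) * ennreal (1 / catalan n)"
        by (simp only: sum_distrib_right)
      also have "(\<Sum>\<sigma>\<in>?A n. indicator (word_perms n w) \<sigma>) = ennreal (real (card (word_perms n w)))"
      proof -
        have "(\<Sum>\<sigma>\<in>?A n. indicator (word_perms n w) \<sigma>) = (\<Sum>\<sigma>\<in>word_perms n w. 1 :: ennreal)"
          by (rule sum.mono_neutral_cong_right) (auto simp: finite_avoiding_perms word_perms_def)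
        then show ?thesis
          by (simp add: ennreal_of_nat_eq_real_of_nat)
      qed
      also have "ennreal (real (card (word_perms n w))) * (if ok n w then G w else 0) * ennreal (1 / catalan n) = a n w"
      proof -
        have "ennreal (real (card (word_perms n w)) / catalan n) = ennreal (real (card (word_perms n w))) * ennreal (1 / catalan n)"
          using catalan_pos[of n] by (simp flip: ennreal_mult)
        then show ?thesis by (simp add: a_def ac_simps)
      qed
      finally show ?thesis by simp
    qed
    \<comment> \<open>At most one word contributes at a given \<open>\<sigma>\<close>, and its
      \<open>G\<close> is a lower bound for \<open>F\<close> at the embedded permutation.\<close>
    have one: "(\<integral>\<^sup>+w. indicator (word_perms n w) \<sigma> * (if ok n w then G w else 0) * ennreal (1 / catalan n) \<partial>?W)
        \<le> F (embed_perm \<sigma>) * ennreal (1 / catalan n)" for \<sigma>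
    proof (cases "\<exists>w. length w = r \<and> \<sigma> \<in> word_perms n w \<and> ok n w")
      case False
      then have "(\<integral>\<^sup>+w. indicator (word_perms n w) \<sigma> * (if ok n w then G w else 0) * ennreal (1 / catalan n) \<partial>?W) = (\<integral>\<^sup>+w. 0 \<partial>?W)"
        by (intro nn_integral_cong) (auto simp: indicator_def)
      then show ?thesis by simp
    next
      case True
      then obtain w0 where w0: "length w0 = r" "\<sigma> \<in> word_perms n w0" "ok n w0" by blast
      have uniq: "w = w0" if "length w = r" "\<sigma> \<in> word_perms n w" "ok n w" for w
        using word_perms_disjoint[of \<sigma> n w w0] that w0 by (simp add: ok_def)
      have "G w0 \<le> F (embed_perm \<sigma>)"
        using w0 by (intro G word_perms_in_word_cylinder) (auto simp: ok_def)
      then have "(\<integral>\<^sup>+w. indicator (word_perms n w) \<sigma> * (if ok n w then G w else 0) * ennreal (1 / catalan n) \<partial>?W)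
          \<le> (\<integral>\<^sup>+w. (F (embed_perm \<sigma>) * ennreal (1 / catalan n)) * indicator {w0} w \<partial>?W)"
      proof (intro nn_integral_mono)
        fix w assume "w \<in> space ?W"
        then have "w = w0" if "\<sigma> \<in> word_perms n w" "ok n w" using uniq that by simp
        with \<open>G w0 \<le> F (embed_perm \<sigma>)\<close>
        show "indicator (word_perms n w) \<sigma> * (if ok n w then G w else 0) * ennreal (1 / catalan n)
           \<le> (F (embed_perm \<sigma>) * ennreal (1 / catalan n)) * indicator {w0} w"
          by (cases "\<sigma> \<in> word_perms n w \<and> ok n w") (auto simp: indicator_def intro!: mult_right_mono)
      qed
      also have "\<dots> = F (embed_perm \<sigma>) * ennreal (1 / catalan n)"
        using w0(1) by (subst nn_integral_cmult_indicator) auto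
      finally show ?thesis .
    qed
    have "(\<integral>\<^sup>+w. a n w \<partial>?W)
        = (\<Sum>\<sigma>\<in>?A n. \<integral>\<^sup>+w. indicator (word_perms n w) \<sigma> * (if ok n w then G w else 0) * ennreal (1 / catalan n) \<partial>?W)"
      unfolding a by (rule nn_integral_sum) simp
    also have "\<dots> \<le> (\<Sum>\<sigma>\<in>?A n. F (embed_perm \<sigma>) * ennreal (1 / catalan n))"
      by (intro sum_mono one)
    finally show ?thesis by (simp only: nn_integral_mu[OF F])
  qed
  have "(\<integral>\<^sup>+w. ennreal (word_weight w) * G w \<partial>?W) = (\<integral>\<^sup>+w. liminf (\<lambda>n. a n w) \<partial>?W)"
    by (intro nn_integral_cong lim_imp_Liminf[symmetric] lim) simp
  also have "\<dots> \<le> liminf (\<lambda>n. \<integral>\<^sup>+w. a n w \<partial>?W)"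
    by (rule nn_integral_liminf) simp
  also have "\<dots> \<le> liminf (\<lambda>n. \<integral>\<^sup>+x. F x \<partial>mu [2, 1, 3] n)"
    by (intro Liminf_mono always_eventually allI le)
  finally show ?thesis .
qed

section \<open>The gaps of the set of finite values\<close>

lemma enumerate_range_strict_mono:
  fixes e :: "nat \<Rightarrow> nat"
  assumes "strict_mono e"
  shows "enumerate (range e) = e"
proof
  have inf: "infinite (range e)"
    using assms by (simp add: range_inj_infinite strict_mono_imp_inj_on)
  fix j
  show "enumerate (range e) j = e j"
  proof (induction j)
    case 0
    show ?case unfolding enumerate_0
      by (rule Least_equality) (use strict_mono_less_eq[OF assms] in auto)
  next
    case (Suc j)
    show ?case unfolding enumerate_Suc''[OF inf] Suc.IH
      by (rule Least_equality)
        (use strict_mono_less_eq[OF assms] strict_mono_less[OF assms] in \<open>auto simp: Suc_le_eq\<close>)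
  qed
qed

lemma partial_sum_0 [simp]: "partial_sum a 0 = 0"
  by (simp add: partial_sum_def)

lemma partial_sum_Suc [simp]: "partial_sum a (Suc n) = partial_sum a n + a (Suc n)"
  by (simp add: partial_sum_def)

lemma partial_sum_mono: "m \<le> n \<Longrightarrow> partial_sum a m \<le> partial_sum a n"
  by (induction rule: dec_induct) auto

lemma partial_sum_add: "partial_sum a (z + m) = partial_sum a z + (\<Sum>i=z+1..z+m. a i)"
  by (induction m) auto

text \<open>The sets \<open>I\<^sup>(\<^sup>1\<^sup>)\<close> and \<open>I\<^sup>(\<^sup>0\<^sup>)\<close> are the cases \<open>d = 0\<close> and \<open>d = 1\<close>.\<close>

definition run_set :: "nat \<Rightarrow> (nat \<Rightarrow> nat) \<Rightarrow> (nat \<Rightarrow> nat) \<Rightarrow> (nat \<Rightarrow> nat) \<Rightarrow> nat set" where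
  "run_set d xh y1 y2 = (\<Union>n.
     {partial_sum y1 n + partial_sum xh (partial_sum y2 (n + d)) + 1 ..
      partial_sum y1 (n + 1) + partial_sum xh (partial_sum y2 (n + d))})"

lemma I1_set_eq: "I1_set = run_set 0" and I0_set_eq: "I0_set = run_set 1"
  by (simp_all add: fun_eq_iff I1_set_def I0_set_def run_set_def)

text \<open>Elements are numbered from 0, and run \<open>n\<close> has length
  \<open>y1 (Suc n)\<close>. For positive \<open>y1\<close> the partial sums are unbounded, so the
  least \<open>n\<close> exists.\<close>

definition run_index :: "(nat \<Rightarrow> nat) \<Rightarrow> nat \<Rightarrow> nat" where
  "run_index y1 j = (LEAST n. j < partial_sum y1 (Suc n))"

text \<open>Without skips the element with index \<open>j\<close> would be \<open>j + 1\<close>; the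
  last summand counts the values skipped before it and is constant within a run.\<close>

definition run_enum :: "nat \<Rightarrow> (nat \<Rightarrow> nat) \<Rightarrow> (nat \<Rightarrow> nat) \<Rightarrow> (nat \<Rightarrow> nat) \<Rightarrow> nat \<Rightarrow> nat" where
  "run_enum d xh y1 y2 j = j + 1 + partial_sum xh (partial_sum y2 (run_index y1 j + d))"

lemma le_partial_sum:
  assumes "\<And>i. 1 \<le> i \<Longrightarrow> 1 \<le> a i"
  shows "n \<le> partial_sum a n"
proof (induction n)
  case (Suc n)
  then show ?case using assms[of "Suc n"] by simp
qed simp

lemma run_index_less:
  assumes "\<And>i. 1 \<le> i \<Longrightarrow> 1 \<le> y1 i"
  shows "j < partial_sum y1 (Suc (run_index y1 j))"
  unfolding run_index_def
proof (rule LeastI)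
  show "j < partial_sum y1 (Suc j)" using le_partial_sum[of y1 "Suc j"] assms by simp
qed

lemma run_index_eq:
  assumes "partial_sum y1 n \<le> j" "j < partial_sum y1 (Suc n)"
  shows "run_index y1 j = n"
  unfolding run_index_def
proof (rule Least_equality)
  show "j < partial_sum y1 (Suc n)" by (fact assms(2))
next
  fix m assume "j < partial_sum y1 (Suc m)"
  then show "n \<le> m"
    using partial_sum_mono[of "Suc m" n y1] assms(1) by (cases "n \<le> m") auto
qed

lemma run_index_ge: "partial_sum y1 (run_index y1 j) \<le> j"
proof (cases "run_index y1 j")
  case (Suc n)
  then have "\<not> j < partial_sum y1 (Suc n)"
    using not_less_Least[of n "\<lambda>n. j < partial_sum y1 (Suc n)"] by (simp add: run_index_def)
  then show ?thesis using Suc by simp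
qed simp

lemma run_index_mono:
  assumes "\<And>i. 1 \<le> i \<Longrightarrow> 1 \<le> y1 i" "i \<le> j"
  shows "run_index y1 i \<le> run_index y1 j"
  using run_index_less[OF assms(1), where j = j] assms(2) unfolding run_index_def[of _ i]
  by (intro Least_le) (rule le_less_trans)

lemma strict_mono_run_enum:
  assumes "\<And>i. 1 \<le> i \<Longrightarrow> 1 \<le> y1 i"
  shows "strict_mono (run_enum d xh y1 y2)"
proof (rule strict_monoI)
  fix i j :: nat assume "i < j"
  then have "partial_sum xh (partial_sum y2 (run_index y1 i + d)) \<le> partial_sum xh (partial_sum y2 (run_index y1 j + d))"
    using run_index_mono[OF assms, where i = i and j = j] by (intro partial_sum_mono) simp
  with \<open>i < j\<close> show "run_enum d xh y1 y2 i < run_enum d xh y1 y2 j" by (simp add: run_enum_def)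
qed

lemma range_run_enum:
  assumes "\<And>i. 1 \<le> i \<Longrightarrow> 1 \<le> y1 i"
  shows "range (run_enum d xh y1 y2) = run_set d xh y1 y2"
proof (intro set_eqI iffI)
  fix v assume "v \<in> range (run_enum d xh y1 y2)"
  then obtain j where "v = run_enum d xh y1 y2 j" by blast
  then show "v \<in> run_set d xh y1 y2"
    using run_index_less[where ?y1.0 = y1 and j = j] assms run_index_ge[of y1 j]
    unfolding run_set_def run_enum_def by (auto intro!: exI[of _ "run_index y1 j"])
next
  fix v assume "v \<in> run_set d xh y1 y2"
  then obtain n where n: "partial_sum y1 n + partial_sum xh (partial_sum y2 (n + d)) + 1 \<le> v"
    "v \<le> partial_sum y1 (n + 1) + partial_sum xh (partial_sum y2 (n + d))"
    by (auto simp: run_set_def)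
  define j where "j = v - partial_sum xh (partial_sum y2 (n + d)) - 1"
  have "run_index y1 j = n" using n by (intro run_index_eq) (auto simp: j_def)
  then have "run_enum d xh y1 y2 j = v" using n by (simp add: run_enum_def j_def)
  then show "v \<in> range (run_enum d xh y1 y2)" by blast
qed

lemma
  assumes "\<And>i. 1 \<le> i \<Longrightarrow> 1 \<le> y1 i"
  shows infinite_run_set: "infinite (run_set d xh y1 y2)"
    and enumerate_run_set: "enumerate (run_set d xh y1 y2) = run_enum d xh y1 y2"
proof -
  have "strict_mono (run_enum d xh y1 y2)" "range (run_enum d xh y1 y2) = run_set d xh y1 y2"
    using assms by (intro strict_mono_run_enum range_run_enum; simp)+
  note * = this
  show "infinite (run_set d xh y1 y2)"
    using * by (metis range_inj_infinite strict_mono_imp_inj_on)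
  show "enumerate (run_set d xh y1 y2) = run_enum d xh y1 y2"
    using enumerate_range_strict_mono[OF *(1)] *(2) by simp
qed

text \<open>Supplies the second components of the word read off from a set; the value 0 acts as
  predecessor of the first element.\<close>

definition gap :: "nat set \<Rightarrow> nat \<Rightarrow> nat" where
  "gap I j = enumerate I j - (if j = 0 then 0 else enumerate I (j - 1)) - 1"

text \<open>\<open>gaps_from n m c z ys\<close>: after \<open>c\<close> elements of the \<open>n\<close>-th run of \<open>I\<close>, with \<open>Y\<^sup>(\<^sup>2\<^sup>)\<^sub>m\<close> the next
  run length of skips and \<open>z\<close> of the \<open>Xh\<close> consumed, the next gaps are \<open>ys\<close>.\<close>

fun gaps_from :: "(nat \<Rightarrow> nat) \<Rightarrow> (nat \<Rightarrow> nat) \<Rightarrow> (nat \<Rightarrow> nat) \<Rightarrow> nat \<Rightarrow> nat \<Rightarrow> nat \<Rightarrow> nat \<Rightarrow> nat list \<Rightarrow> bool" where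
  "gaps_from xh y1 y2 n m c z [] \<longleftrightarrow> True"
| "gaps_from xh y1 y2 n m c z (y # ys) \<longleftrightarrow>
     (if c < y1 n then y = 0 \<and> gaps_from xh y1 y2 n m (c + 1) z ys
      else y = (\<Sum>i=z+1..z+y2 m. xh i) \<and> gaps_from xh y1 y2 (n + 1) (m + 1) 1 (z + y2 m) ys)"

text \<open>The element with index \<open>j\<close> is preceded by \<open>c\<close> elements of the
  current run, whose length is \<open>y1 (Suc n)\<close>: either it belongs to the same run, with
  gap 0, or it opens the next run after a skip. The shift by \<open>d\<close> accounts for the skip
  in front of the first run when \<open>d = 1\<close>. Since \<open>c \<ge> 1\<close>, the very
  first gap is left to \<open>gap_0\<close>.\<close>

lemma gaps_from_gap:
  assumes pos: "\<And>i. 1 \<le> i \<Longrightarrow> 1 \<le> y1 i"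
    and c: "1 \<le> c" "c \<le> y1 (Suc n)"
    and j: "j = partial_sum y1 n + c" and z: "z = partial_sum y2 (n + d)"
  shows "gaps_from xh y1 y2 (Suc n) (Suc n + d) c z (map (gap (run_set d xh y1 y2)) [j..<j + r])"
  using c j z
proof (induction r arbitrary: n c j z)
  case (Suc r)
  have gap: "gap (run_set d xh y1 y2) j = run_enum d xh y1 y2 j - run_enum d xh y1 y2 (j - 1) - 1"
    using Suc.prems by (simp add: gap_def enumerate_run_set[OF pos])
  have prev: "run_index y1 (j - 1) = n"
    using Suc.prems by (intro run_index_eq) auto
  have upt: "[j..<j + Suc r] = j # [Suc j..<Suc j + r]"
    by (simp add: upt_rec)
  show ?case
  proof (cases "c < y1 (Suc n)")
    case True
    then have "run_index y1 j = n"
      using Suc.prems by (intro run_index_eq) auto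
    then have "gap (run_set d xh y1 y2) j = 0"
      unfolding gap run_enum_def prev using Suc.prems by simp
    moreover have "gaps_from xh y1 y2 (Suc n) (Suc n + d) (c + 1) z (map (gap (run_set d xh y1 y2)) [Suc j..<Suc j + r])"
      using True Suc.prems by (intro Suc.IH) auto
    ultimately show ?thesis using True unfolding upt by simp
  next
    case False
    with Suc.prems have c: "c = y1 (Suc n)" by simp
    then have "run_index y1 j = Suc n"
      using Suc.prems pos[of "Suc (Suc n)"] by (intro run_index_eq) auto
    then have "gap (run_set d xh y1 y2) j = (\<Sum>i=z+1..z+y2 (Suc n + d). xh i)"
      unfolding gap run_enum_def prev using Suc.prems c
      using partial_sum_add[of xh z "y2 (Suc n + d)"] by simp
    moreover have "gaps_from xh y1 y2 (Suc (Suc n)) (Suc (Suc n) + d) 1 (z + y2 (Suc n + d)) (map (gap (run_set d xh y1 y2)) [Suc j..<Suc j + r])"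
      using c Suc.prems pos[of "Suc (Suc n)"] by (intro Suc.IH) auto
    ultimately show ?thesis using False unfolding upt by simp
  qed
qed simp

text \<open>The value is 0 for \<open>d = 0\<close> and the whole first skip for
  \<open>d = 1\<close>; with positive variables the first gap therefore tells which of the two sets
  was chosen.\<close>

lemma gap_0:
  assumes pos: "\<And>i. 1 \<le> i \<Longrightarrow> 1 \<le> y1 i"
  shows "gap (run_set d xh y1 y2) 0 = partial_sum xh (partial_sum y2 d)"
proof -
  have "run_index y1 0 = 0" using pos[of 1] by (intro run_index_eq) auto
  then show ?thesis by (simp add: gap_def enumerate_run_set[OF pos] run_enum_def)
qed

text \<open>The first skip has positive length: it removes \<open>y1 1 + 1\<close> if
  \<open>d = 0\<close>, and \<open>1\<close> if \<open>d = 1\<close>.\<close>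

lemma run_set_missing:
  assumes pos: "\<And>i. 1 \<le> i \<Longrightarrow> 1 \<le> y1 i" "\<And>i. 1 \<le> i \<Longrightarrow> 1 \<le> y2 i" "\<And>i. 1 \<le> i \<Longrightarrow> 1 \<le> xh i" and d: "d \<le> 1"
  shows "\<exists>v\<ge>1. v \<notin> run_set d xh y1 y2"
proof -
  have skip: "1 \<le> partial_sum xh (partial_sum y2 1)"
    using le_partial_sum[of y2 1] le_partial_sum[of xh "partial_sum y2 1"] pos by (meson order_trans)
  let ?e = "run_enum d xh y1 y2"
  have mono: "?e i < ?e j \<longleftrightarrow> i < j" for i j
    using strict_mono_less[OF strict_mono_run_enum[OF pos(1)]] .
  show ?thesis
  proof (cases "d = 0")
    case True
    have "run_index y1 (y1 1) = 1" using pos(1)[of 2] by (intro run_index_eq) (auto simp: numeral_2_eq_2)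
    then have 2: "y1 1 + 1 < ?e (y1 1)" using skip True by (simp add: run_enum_def)
    have "run_index y1 (y1 1 - 1) = 0" using pos(1)[of 1] by (intro run_index_eq) auto
    then have 1: "?e (y1 1 - 1) = y1 1" using True pos(1)[of 1] by (simp add: run_enum_def)
    have "?e j \<noteq> y1 1 + 1" for j
    proof
      assume j: "?e j = y1 1 + 1"
      then have "y1 1 - 1 < j" "j < y1 1" using 1 2 mono[of "y1 1 - 1" j] mono[of j "y1 1"] by auto
      then show False by simp
    qed
    then have "y1 1 + 1 \<notin> range ?e" by (metis rangeE)
    then have "y1 1 + 1 \<notin> run_set d xh y1 y2" using range_run_enum[where ?y1.0 = y1] pos(1) by metis
    then show ?thesis by (intro exI[of _ "y1 1 + 1"]) simp
  next
    case False
    then have "d = 1" using d by simp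
    have "run_index y1 0 = 0" using pos(1)[of 1] by (intro run_index_eq) auto
    then have "1 < ?e 0" using skip \<open>d = 1\<close> by (simp add: run_enum_def)
    then have "?e j \<noteq> 1" for j using mono[of j 0] by (metis not_less0)
    then have "1 \<notin> range ?e" by (metis rangeE)
    then have "1 \<notin> run_set d xh y1 y2" using range_run_enum[where ?y1.0 = y1] pos(1) by metis
    then show ?thesis by (intro exI[of _ 1]) simp
  qed
qed

section \<open>The law of the gaps\<close>

locale limit_variables = prob_space M for M :: "'w measure" +
  fixes X Xh Y1 Y2 :: "nat \<Rightarrow> 'w \<Rightarrow> nat" and chi :: "'w \<Rightarrow> nat"
  assumes indep: "indep_vars (\<lambda>_. count_space UNIV) (rv_family X Xh Y1 Y2 chi) rv_indices"
    and X_law: "n \<ge> 1 \<Longrightarrow> prob {\<omega> \<in> space M. X n \<omega> = k} = crit k"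
    and Xh_law: "n \<ge> 1 \<Longrightarrow> distr M (count_space UNIV) (Xh n) = distr M (count_space UNIV) (\<lambda>\<omega>. X 1 \<omega> + 1)"
    and Y1_law: "n \<ge> 1 \<Longrightarrow> k \<ge> 1 \<Longrightarrow> prob {\<omega> \<in> space M. Y1 n \<omega> = k} = (1/2) ^ k"
    and Y2_law: "n \<ge> 1 \<Longrightarrow> k \<ge> 1 \<Longrightarrow> prob {\<omega> \<in> space M. Y2 n \<omega> = k} = (1/2) ^ k"
    and chi_0: "prob {\<omega> \<in> space M. chi \<omega> = 0} = 1/2"
    and chi_1: "prob {\<omega> \<in> space M. chi \<omega> = 1} = 1/2"
begin

abbreviation "family \<equiv> rv_family X Xh Y1 Y2 chi"

lemma family_measurable: "i \<in> rv_indices \<Longrightarrow> family i \<in> measurable M (count_space UNIV)"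
  using indep by (simp add: indep_vars_def)

lemma
  assumes "1 \<le> n"
  shows X_measurable: "X n \<in> measurable M (count_space UNIV)"
    and Xh_measurable: "Xh n \<in> measurable M (count_space UNIV)"
    and Y1_measurable: "Y1 n \<in> measurable M (count_space UNIV)"
    and Y2_measurable: "Y2 n \<in> measurable M (count_space UNIV)"
  using family_measurable[of "Idx_X n"] family_measurable[of "Idx_Xh n"]
    family_measurable[of "Idx_Y1 n"] family_measurable[of "Idx_Y2 n"] assms
  by (auto simp: rv_indices_def)

lemma chi_measurable: "chi \<in> measurable M (count_space UNIV)"
  using family_measurable[of Idx_chi] by (simp add: rv_indices_def)

lemma count_space_events:
  assumes "f \<in> measurable M (count_space UNIV)"
  shows "{\<omega> \<in> space M. P (f \<omega>)} \<in> events"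
  using measurable_sets[OF assms, of "{v. P v}"] by (simp add: vimage_def Int_def conj_commute)

text \<open>The masses prescribed for \<open>k \<ge> 1\<close> already add up to 1, which makes the
  value 0 null and bounds the tails.\<close>

lemma geometric_bounds:
  assumes f: "f \<in> measurable M (count_space UNIV)"
    and law: "\<And>k::nat. k \<ge> 1 \<Longrightarrow> prob {\<omega> \<in> space M. f \<omega> = k} = (1/2) ^ k"
  shows "1 \<le> c \<Longrightarrow> prob {\<omega> \<in> space M. f \<omega> \<in> {c..}} \<le> (1/2) ^ (c - 1)"
    and "AE \<omega> in M. 1 \<le> f \<omega>"
proof -
  have sum: "prob {\<omega> \<in> space M. f \<omega> \<in> {1..<1 + N}} = 1 - (1/2) ^ N" for N
  proof (induction N)
    case (Suc N)
    have "{\<omega> \<in> space M. f \<omega> \<in> {1..<1 + Suc N}} = {\<omega> \<in> space M. f \<omega> \<in> {1..<1 + N}} \<union> {\<omega> \<in> space M. f \<omega> = Suc N}"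
      by auto
    also have "prob \<dots> = prob {\<omega> \<in> space M. f \<omega> \<in> {1..<1 + N}} + prob {\<omega> \<in> space M. f \<omega> = Suc N}"
      by (rule finite_measure_Union) (auto intro: count_space_events[OF f])
    finally show ?case using Suc.IH law[of "Suc N"] by simp
  qed simp
  have compl: "prob {\<omega> \<in> space M. f \<omega> \<notin> {1..<1 + N}} = (1/2) ^ N" for N
    using prob_neg[OF count_space_events[OF f, of "\<lambda>v. v \<in> {1..<1 + N}"]] sum[of N] by simp
  show "prob {\<omega> \<in> space M. f \<omega> \<in> {c..}} \<le> (1/2) ^ (c - 1)" if "1 \<le> c"
  proof -
    have "prob {\<omega> \<in> space M. f \<omega> \<in> {c..}} \<le> prob {\<omega> \<in> space M. f \<omega> \<notin> {1..<1 + (c - 1)}}"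
      using that by (intro finite_measure_mono count_space_events[OF f]) auto
    then show ?thesis unfolding compl .
  qed
  have "prob {\<omega> \<in> space M. f \<omega> = 0} \<le> (1/2) ^ N" for N
    unfolding compl[symmetric] by (intro finite_measure_mono count_space_events[OF f]) auto
  then have "prob {\<omega> \<in> space M. f \<omega> = 0} \<le> 0"
    by (intro LIMSEQ_le_const[OF LIMSEQ_realpow_zero[of "1/2"]]) auto
  then have "prob {\<omega> \<in> space M. f \<omega> = 0} = 0"
    by (meson measure_nonneg order_antisym)
  then have "AE \<omega> in M. \<not> f \<omega> = 0"
    using prob_eq_0[OF count_space_events[OF f, of "\<lambda>v. v = 0"]] by (auto elim: AE_mp)
  then show "AE \<omega> in M. 1 \<le> f \<omega>" by (rule AE_mp) auto
qed

lemma Xh_prob: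
  assumes "1 \<le> n"
  shows "prob {\<omega> \<in> space M. Xh n \<omega> = v} = (if v = 0 then 0 else crit (v - 1))"
proof -
  have X1: "(\<lambda>\<omega>. X 1 \<omega> + 1) \<in> measurable M (count_space UNIV)"
    using X_measurable[of 1] by (intro measurable_compose[OF _ measurable_count_space]) auto
  have "prob {\<omega> \<in> space M. Xh n \<omega> = v} = measure (distr M (count_space UNIV) (Xh n)) {v}"
    using Xh_measurable[OF assms] by (simp add: measure_distr vimage_def Int_def conj_commute)
  also have "\<dots> = measure (distr M (count_space UNIV) (\<lambda>\<omega>. X 1 \<omega> + 1)) {v}"
    using Xh_law[OF assms] by simp
  also have "\<dots> = prob {\<omega> \<in> space M. X 1 \<omega> + 1 = v}"
    using X1 by (simp add: measure_distr vimage_def Int_def conj_commute)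
  also have "\<dots> = (if v = 0 then 0 else crit (v - 1))"
  proof (cases v)
    case (Suc u)
    then have "{\<omega> \<in> space M. X 1 \<omega> + 1 = v} = {\<omega> \<in> space M. X 1 \<omega> = u}" by auto
    then show ?thesis using Suc X_law[of 1 u] by simp
  qed simp
  finally show ?thesis .
qed

text \<open>The almost sure conditions under which runs and skips are nonempty and
  \<open>chi\<close> selects one of the two sets; the pointwise analysis of the gaps takes place
  here.\<close>

definition good :: "'w \<Rightarrow> bool" where
  "good \<omega> \<longleftrightarrow> (\<forall>i\<ge>1. 1 \<le> Y1 i \<omega> \<and> 1 \<le> Y2 i \<omega> \<and> 1 \<le> Xh i \<omega>) \<and> (chi \<omega> = 0 \<or> chi \<omega> = 1)"

lemma AE_good: "AE \<omega> in M. good \<omega>"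
proof -
  have "AE \<omega> in M. 1 \<le> Y1 i \<omega> \<and> 1 \<le> Y2 i \<omega> \<and> 1 \<le> Xh i \<omega>" if "i \<ge> 1" for i
  proof -
    have "AE \<omega> in M. 1 \<le> Y1 i \<omega>" using Y1_measurable Y1_law that by (intro geometric_bounds(2)) auto
    moreover have "AE \<omega> in M. 1 \<le> Y2 i \<omega>" using Y2_measurable Y2_law that by (intro geometric_bounds(2)) auto
    moreover have "AE \<omega> in M. \<not> Xh i \<omega> = 0"
      using Xh_prob[OF that, of 0] prob_eq_0[OF count_space_events[OF Xh_measurable[OF that], of "\<lambda>v. v = 0"]]
      by (auto elim: AE_mp)
    ultimately show ?thesis by eventually_elim auto
  qed
  then have "AE \<omega> in M. \<forall>i. i \<ge> 1 \<longrightarrow> 1 \<le> Y1 i \<omega> \<and> 1 \<le> Y2 i \<omega> \<and> 1 \<le> Xh i \<omega>"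
    by (simp add: AE_all_countable AE_impI)
  moreover have "AE \<omega> in M. chi \<omega> = 0 \<or> chi \<omega> = 1"
  proof -
    have "prob ({\<omega> \<in> space M. chi \<omega> = 0} \<union> {\<omega> \<in> space M. chi \<omega> = 1}) = 1"
      by (subst finite_measure_Union) (auto intro: count_space_events[OF chi_measurable] simp: chi_0 chi_1[unfolded One_nat_def])
    then have "AE \<omega> in M. \<omega> \<in> {\<omega> \<in> space M. chi \<omega> = 0} \<union> {\<omega> \<in> space M. chi \<omega> = 1}"
      by (intro prob_eq_1[THEN iffD1]) (auto intro: count_space_events[OF chi_measurable])
    then show ?thesis by (rule AE_mp) auto
  qed
  ultimately show ?thesis by eventually_elim (auto simp: good_def)
qed

section \<open>Revealing finitely many variables, and bounds by covering\<close>

definition constraint :: "rv_index set \<Rightarrow> (rv_index \<Rightarrow> nat set) \<Rightarrow> 'w set" where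
  "constraint K A = {\<omega> \<in> space M. \<forall>i\<in>K. family i \<omega> \<in> A i}"

definition pr :: "rv_index \<Rightarrow> nat set \<Rightarrow> real" where
  "pr i B = prob {\<omega> \<in> space M. family i \<omega> \<in> B}"

lemma pr_nonneg: "0 \<le> pr i B"
  by (simp add: pr_def)

text \<open>Independence, applied to the set \<open>K\<close> of variables revealed so far. Empty
  \<open>K\<close> is treated apart, since an intersection over no index is not
  \<open>space M\<close>.\<close>

lemma constraint_prob:
  assumes "finite K" "K \<subseteq> rv_indices"
  shows "constraint K A \<in> events" "prob (constraint K A) = (\<Prod>i\<in>K. pr i (A i))"
proof -
  have "constraint K A \<in> events \<and> prob (constraint K A) = (\<Prod>i\<in>K. pr i (A i))"
  proof (cases "K = {}")
    case True
    then show ?thesis by (simp add: constraint_def prob_space)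
  next
    case False
    have eq: "constraint K A = (\<Inter>i\<in>K. family i -` A i \<inter> space M)"
      using False by (auto simp: constraint_def)
    have "(\<Inter>i\<in>K. family i -` A i \<inter> space M) \<in> events"
      using assms False by (intro sets.finite_INT measurable_sets[OF family_measurable]) auto
    moreover have "prob (\<Inter>i\<in>K. family i -` A i \<inter> space M) = (\<Prod>i\<in>K. prob (family i -` A i \<inter> space M))"
      by (rule indep_varsD[OF indep False assms]) simp
    ultimately show ?thesis
      unfolding eq by (simp add: pr_def vimage_def Int_def conj_commute)
  qed
  then show "constraint K A \<in> events" "prob (constraint K A) = (\<Prod>i\<in>K. pr i (A i))" by auto
qed

text \<open>Outer probability bounds, so that events need not be shown measurable one by one.\<close>

definition covered :: "'w set \<Rightarrow> real \<Rightarrow> bool" where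
  "covered S b \<longleftrightarrow> (\<exists>E\<in>events. S \<subseteq> E \<and> prob E \<le> b)"

lemma covered_mono: "covered S b \<Longrightarrow> S' \<subseteq> S \<Longrightarrow> b \<le> b' \<Longrightarrow> covered S' b'"
  unfolding covered_def by (meson order_trans)

lemma covered_UN:
  assumes "finite I" "\<And>i. i \<in> I \<Longrightarrow> covered (S i) (b i)"
  shows "covered (\<Union>i\<in>I. S i) (\<Sum>i\<in>I. b i)"
proof -
  obtain E where E: "\<And>i. i \<in> I \<Longrightarrow> E i \<in> events \<and> S i \<subseteq> E i \<and> prob (E i) \<le> b i"
    using assms(2) unfolding covered_def by metis
  have "prob (\<Union>i\<in>I. E i) \<le> (\<Sum>i\<in>I. prob (E i))"
    using assms(1) E by (intro finite_measure_subadditive_finite) auto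
  also have "\<dots> \<le> (\<Sum>i\<in>I. b i)" using E by (intro sum_mono) auto
  finally have "prob (\<Union>i\<in>I. E i) \<le> (\<Sum>i\<in>I. b i)" .
  moreover have "(\<Union>i\<in>I. E i) \<in> events" using assms(1) E by auto
  ultimately show ?thesis using E unfolding covered_def by (intro bexI[of _ "\<Union>i\<in>I. E i"]) auto
qed

text \<open>A skip of length \<open>y\<close> is resolved by its composition \<open>l\<close>: the
  event is covered by the events that \<open>Y2 m\<close> is \<open>length l\<close> and the next
  \<open>Xh\<close> variables are the entries of \<open>l\<close>. None of these variables is
  revealed yet, so probabilities multiply, and \<open>sum_comps_crit\<close> adds them up to
  \<open>2 * crit y\<close>. The remaining event \<open>R\<close> enters through \<open>H\<close>,
  with a factor \<open>b\<close> that is the same for all revealed values.\<close>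

lemma covered_skip:
  assumes K: "finite K" "K \<subseteq> rv_indices" and m: "1 \<le> m" "Idx_Y2 m \<notin> K" and z: "\<And>t. z < t \<Longrightarrow> Idx_Xh t \<notin> K"
    and y: "1 \<le> y"
    and H: "\<And>l A'. l \<in> comps y \<Longrightarrow> K' l = insert (Idx_Y2 m) (K \<union> Idx_Xh ` {z<..z + length l}) \<Longrightarrow>
       covered {\<omega> \<in> constraint (K' l) A'. good \<omega> \<and> R (length l) \<omega>} ((\<Prod>i\<in>K' l. pr i (A' i)) * b)"
    and K': "K' = (\<lambda>l. insert (Idx_Y2 m) (K \<union> Idx_Xh ` {z<..z + length l}))"
  shows "covered {\<omega> \<in> constraint K A. good \<omega> \<and> y = (\<Sum>i=z+1..z + Y2 m \<omega>. Xh i \<omega>) \<and> R (Y2 m \<omega>) \<omega>}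
    ((\<Prod>i\<in>K. pr i (A i)) * (2 * crit y) * b)" (is "covered ?S _")
proof -
  define A' where "A' l i = (case i of Idx_Y2 t \<Rightarrow> if t = m then {length l} else A i
      | Idx_Xh t \<Rightarrow> if z < t \<and> t \<le> z + length l then {l ! (t - z - 1)} else A i | _ \<Rightarrow> A i)" for l :: "nat list" and i
  have prod: "(\<Prod>i\<in>K' l. pr i (A' l i)) = (\<Prod>i\<in>K. pr i (A i)) * ((1/2) ^ length l * (\<Prod>i\<leftarrow>l. crit (i - 1)))"
    if l: "l \<in> comps y" for l
  proof -
    have "(\<Prod>i\<in>K' l. pr i (A' l i)) = pr (Idx_Y2 m) {length l} * ((\<Prod>i\<in>K. pr i (A' l i)) * (\<Prod>i\<in>Idx_Xh ` {z<..z + length l}. pr i (A' l i)))"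
      unfolding K' using K(1) m z by (subst prod.insert) (auto simp: A'_def intro!: prod.union_disjoint)
    also have "(\<Prod>i\<in>K. pr i (A' l i)) = (\<Prod>i\<in>K. pr i (A i))"
      using m z by (intro prod.cong refl) (auto simp: A'_def split: rv_index.split)
    also have "(\<Prod>i\<in>Idx_Xh ` {z<..z + length l}. pr i (A' l i)) = (\<Prod>t\<in>{z<..z + length l}. pr (Idx_Xh t) {l ! (t - z - 1)})"
      by (subst prod.reindex) (auto simp: inj_on_def A'_def intro!: prod.cong)
    also have "\<dots> = (\<Prod>t\<in>{z<..z + length l}. crit (l ! (t - z - 1) - 1))"
    proof (intro prod.cong refl)
      fix t assume t: "t \<in> {z<..z + length l}"
      then have "l ! (t - z - 1) \<in> set l" by (intro nth_mem) auto
      then have "l ! (t - z - 1) \<noteq> 0" using l unfolding comps_def by (metis (mono_tags, lifting) mem_Collect_eq)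
      then show "pr (Idx_Xh t) {l ! (t - z - 1)} = crit (l ! (t - z - 1) - 1)"
        using t Xh_prob[of t "l ! (t - z - 1)"] by (auto simp: pr_def)
    qed
    also have "\<dots> = (\<Prod>i\<leftarrow>l. crit (i - 1))"
      unfolding prod.list_conv_set_nth
      by (rule prod.reindex_bij_witness[of _ "\<lambda>i. z + 1 + i" "\<lambda>t. t - z - 1"]) auto
    \<comment> \<open>As \<open>y \<ge> 1\<close>, the composition is nonempty, and the law of
      \<open>Y2\<close> applies to its length.\<close>
    also have "pr (Idx_Y2 m) {length l} = (1/2) ^ length l"
      using l y m Y2_law[of m "length l"] by (cases l) (auto simp: pr_def comps_def)
    finally show ?thesis by simp
  qed
  have "covered (\<Union>l\<in>comps y. {\<omega> \<in> constraint (K' l) (A' l). good \<omega> \<and> R (length l) \<omega>})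
      (\<Sum>l\<in>comps y. (\<Prod>i\<in>K' l. pr i (A' l i)) * b)"
    by (intro covered_UN finite_comps H) (auto simp: K')
  then show ?thesis
  proof (rule covered_mono)
    show "?S \<subseteq> (\<Union>l\<in>comps y. {\<omega> \<in> constraint (K' l) (A' l). good \<omega> \<and> R (length l) \<omega>})"
    proof
      fix \<omega> assume \<omega>: "\<omega> \<in> ?S"
      define l where "l = map (\<lambda>t. Xh t \<omega>) [z+1..<z+1+Y2 m \<omega>]"
      have len: "length l = Y2 m \<omega>" by (simp add: l_def)
      have "sum_list l = y"
        using \<omega> by (simp add: l_def sum_list_distinct_conv_sum_set atLeastLessThanSuc_atLeastAtMost)
      moreover have "0 \<notin> set l"
      proof
        assume "0 \<in> set l"
        then obtain t where "z + 1 \<le> t" "Xh t \<omega> = 0" by (auto simp: l_def)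
        moreover have "good \<omega>" using \<omega> by simp
        moreover have "1 \<le> t" using \<open>z + 1 \<le> t\<close> by simp
        ultimately have "1 \<le> Xh t \<omega>" unfolding good_def by blast
        with \<open>Xh t \<omega> = 0\<close> show False by simp
      qed
      ultimately have "l \<in> comps y" by (simp add: comps_def)
      moreover have "\<omega> \<in> constraint (K' l) (A' l)"
        using \<omega> by (auto simp: constraint_def K' A'_def len l_def split: rv_index.split)
      ultimately show "\<omega> \<in> (\<Union>l\<in>comps y. {\<omega> \<in> constraint (K' l) (A' l). good \<omega> \<and> R (length l) \<omega>})"
        using \<omega> len by auto
    qed
    have "(\<Sum>l\<in>comps y. (\<Prod>i\<in>K' l. pr i (A' l i)) * b)
        = (\<Sum>l\<in>comps y. ((\<Prod>i\<in>K. pr i (A i)) * b) * ((1/2) ^ length l * (\<Prod>i\<leftarrow>l. crit (i - 1))))"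
      by (intro sum.cong refl) (simp add: prod)
    also have "\<dots> = (\<Prod>i\<in>K. pr i (A i)) * (2 * crit y) * b"
      by (simp only: sum_distrib_left[symmetric] sum_comps_crit) simp
    finally show "(\<Sum>l\<in>comps y. (\<Prod>i\<in>K' l. pr i (A' l i)) * b) \<le> (\<Prod>i\<in>K. pr i (A i)) * (2 * crit y) * b" by simp
  qed
qed

lemma prod_pr_update:
  assumes "finite K" "k \<notin> K"
  shows "(\<Prod>i\<in>insert k K. pr i ((A(k := B)) i)) = pr k B * (\<Prod>i\<in>K. pr i (A i))"
proof -
  have "(\<Prod>i\<in>K. pr i ((A(k := B)) i)) = (\<Prod>i\<in>K. pr i (A i))"
    using assms by (intro prod.cong) auto
  then show ?thesis using assms by simp
qed

abbreviation "gaps_at \<omega> \<equiv> gaps_from (\<lambda>i. Xh i \<omega>) (\<lambda>i. Y1 i \<omega>) (\<lambda>i. Y2 i \<omega>)"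

text \<open>Memorylessness of the run lengths: once \<open>c\<close> elements of a run are seen,
  \<open>c \<le> Y1 n\<close> costs \<open>(1/2) ^ (c - 1)\<close>. A gap 0 continues the run at the
  further cost 1/2, which is \<open>crit 0\<close>. A gap \<open>y > 0\<close> needs
  \<open>Y1 n = c\<close>, of probability \<open>(1/2) ^ c\<close>, and a skip, contributing
  \<open>2 * crit y\<close>; the product is again \<open>(1/2) ^ (c - 1) * crit y\<close>, and a new
  run starts with \<open>c = 1\<close>. The conditions on \<open>K\<close> say that the variables
  still to come are unrevealed.\<close>

lemma covered_gaps_from:
  assumes "1 \<le> n" "1 \<le> m" "1 \<le> c" "finite K" "K \<subseteq> rv_indices"
    "\<And>t. n \<le> t \<Longrightarrow> Idx_Y1 t \<notin> K" "\<And>t. m \<le> t \<Longrightarrow> Idx_Y2 t \<notin> K" "\<And>t. z < t \<Longrightarrow> Idx_Xh t \<notin> K"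
  shows "covered {\<omega> \<in> constraint K A. good \<omega> \<and> c \<le> Y1 n \<omega> \<and> gaps_at \<omega> n m c z ys}
    ((\<Prod>i\<in>K. pr i (A i)) * ((1/2) ^ (c - 1) * (\<Prod>y\<leftarrow>ys. crit y)))"
  using assms
proof (induction ys arbitrary: n m c z K A)
  case Nil
  let ?K = "insert (Idx_Y1 n) K" and ?A = "A(Idx_Y1 n := {c..})"
  have K: "finite ?K" "?K \<subseteq> rv_indices" using Nil by (auto simp: rv_indices_def)
  have "pr (Idx_Y1 n) {c..} \<le> (1/2) ^ (c - 1)"
    unfolding pr_def rv_family.simps
    by (rule geometric_bounds(1)) (use Nil Y1_law Y1_measurable in auto)
  then have "prob (constraint ?K ?A) \<le> (1/2) ^ (c - 1) * (\<Prod>i\<in>K. pr i (A i))"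
    unfolding constraint_prob(2)[OF K] using Nil
    by (subst prod_pr_update) (auto intro!: mult_right_mono prod_nonneg pr_nonneg)
  moreover have "constraint K A \<inter> {\<omega>. c \<le> Y1 n \<omega>} \<subseteq> constraint ?K ?A"
    by (auto simp: constraint_def)
  ultimately show ?case
    unfolding covered_def by (intro bexI[OF _ constraint_prob(1)[OF K]]) (auto simp: mult.commute)
next
  case (Cons y ys)
  show ?case
  proof (cases "y = 0")
    case True
    have "covered {\<omega> \<in> constraint K A. good \<omega> \<and> c + 1 \<le> Y1 n \<omega> \<and> gaps_at \<omega> n m (c + 1) z ys}
        ((\<Prod>i\<in>K. pr i (A i)) * ((1/2) ^ (c + 1 - 1) * (\<Prod>y\<leftarrow>ys. crit y)))"
      using Cons.prems by (intro Cons.IH) auto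
    then show ?thesis
    proof (rule covered_mono)
      have "(1/2::real) ^ c = (1/2) ^ (c - 1) * crit 0"
        using Cons.prems(3) by (cases c) (auto simp: crit_def)
      then show "(\<Prod>i\<in>K. pr i (A i)) * ((1/2) ^ (c + 1 - 1) * (\<Prod>y\<leftarrow>ys. crit y))
          \<le> (\<Prod>i\<in>K. pr i (A i)) * ((1/2) ^ (c - 1) * (\<Prod>y\<leftarrow>y # ys. crit y))"
        using True by simp
      show "{\<omega> \<in> constraint K A. good \<omega> \<and> c \<le> Y1 n \<omega> \<and> gaps_at \<omega> n m c z (y # ys)}
          \<subseteq> {\<omega> \<in> constraint K A. good \<omega> \<and> c + 1 \<le> Y1 n \<omega> \<and> gaps_at \<omega> n m (c + 1) z ys}"
      proof (intro subsetI)
        fix \<omega> assume \<omega>: "\<omega> \<in> {\<omega> \<in> constraint K A. good \<omega> \<and> c \<le> Y1 n \<omega> \<and> gaps_at \<omega> n m c z (y # ys)}"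
        \<comment> \<open>Under \<open>good\<close> every skip is positive, so a gap 0 cannot mark
          the end of a run.\<close>
        have "c < Y1 n \<omega>"
        proof (rule ccontr)
          assume "\<not> c < Y1 n \<omega>"
          then have "(\<Sum>i=z+1..z + Y2 m \<omega>. Xh i \<omega>) = 0" using \<omega> True by simp
          moreover have "z + 1 \<in> {z+1..z + Y2 m \<omega>}" using \<omega> Cons.prems(2) by (auto simp: good_def)
          ultimately have "Xh (z + 1) \<omega> = 0" by (metis finite_atLeastAtMost sum_eq_0_iff)
          moreover have "1 \<le> Xh (z + 1) \<omega>" using \<omega> by (auto simp: good_def)
          ultimately show False by simp
        qed
        with \<omega> show "\<omega> \<in> {\<omega> \<in> constraint K A. good \<omega> \<and> c + 1 \<le> Y1 n \<omega> \<and> gaps_at \<omega> n m (c + 1) z ys}"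
          by simp
      qed
    qed
  next
    case False
    let ?K = "insert (Idx_Y1 n) K" and ?A = "A(Idx_Y1 n := {c})"
    let ?R = "\<lambda>k \<omega>. 1 \<le> Y1 (n + 1) \<omega> \<and> gaps_at \<omega> (n + 1) (m + 1) 1 (z + k) ys"
    have "covered {\<omega> \<in> constraint ?K ?A. good \<omega> \<and> y = (\<Sum>i=z+1..z + Y2 m \<omega>. Xh i \<omega>) \<and> ?R (Y2 m \<omega>) \<omega>}
        ((\<Prod>i\<in>?K. pr i (?A i)) * (2 * crit y) * ((1/2) ^ (1 - 1) * (\<Prod>y\<leftarrow>ys. crit y)))"
    proof (rule covered_skip[OF _ _ Cons.prems(2) _ _ _ _ refl])
      fix l :: "nat list" and A'
      show "covered {\<omega> \<in> constraint (insert (Idx_Y2 m) (?K \<union> Idx_Xh ` {z<..z + length l})) A'. good \<omega> \<and> ?R (length l) \<omega>}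
          ((\<Prod>i\<in>insert (Idx_Y2 m) (?K \<union> Idx_Xh ` {z<..z + length l}). pr i (A' i)) * ((1/2) ^ (1 - 1) * (\<Prod>y\<leftarrow>ys. crit y)))"
        by (rule Cons.IH) (use Cons.prems in \<open>auto simp: rv_indices_def\<close>)
    qed (use Cons.prems False in \<open>auto simp: rv_indices_def\<close>)
    then show ?thesis
    proof (rule covered_mono)
      have "pr (Idx_Y1 n) {c} = (1/2) ^ c"
        using Y1_law[of n c] Cons.prems by (simp add: pr_def)
      also have "\<dots> * 2 = (1/2) ^ (c - 1)" using Cons.prems(3) by (cases c) auto
      finally have c: "pr (Idx_Y1 n) {c} * 2 = (1/2) ^ (c - 1)" by simp
      have "(\<Prod>i\<in>?K. pr i (?A i)) = pr (Idx_Y1 n) {c} * (\<Prod>i\<in>K. pr i (A i))"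
        using Cons.prems by (intro prod_pr_update) auto
      then show "(\<Prod>i\<in>?K. pr i (?A i)) * (2 * crit y) * ((1/2) ^ (1 - 1) * (\<Prod>y\<leftarrow>ys. crit y))
          \<le> (\<Prod>i\<in>K. pr i (A i)) * ((1/2) ^ (c - 1) * (\<Prod>y\<leftarrow>y # ys. crit y))"
        unfolding c[symmetric] by (simp add: mult_ac)
      show "{\<omega> \<in> constraint K A. good \<omega> \<and> c \<le> Y1 n \<omega> \<and> gaps_at \<omega> n m c z (y # ys)}
          \<subseteq> {\<omega> \<in> constraint ?K ?A. good \<omega> \<and> y = (\<Sum>i=z+1..z + Y2 m \<omega>. Xh i \<omega>) \<and> ?R (Y2 m \<omega>) \<omega>}"
        using False by (auto simp: constraint_def good_def split: if_splits)
    qed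
  qed
qed

definition limit_set :: "'w \<Rightarrow> nat set" where
  "limit_set \<omega> = run_set (if chi \<omega> = 1 then 0 else 1) (\<lambda>i. Xh i \<omega>) (\<lambda>i. Y1 i \<omega>) (\<lambda>i. Y2 i \<omega>)"

definition limit_word :: "nat \<Rightarrow> 'w \<Rightarrow> (nat \<times> nat) list" where
  "limit_word r \<omega> = map (\<lambda>j. (X (Suc j) \<omega>, gap (limit_set \<omega>) j)) [0..<r]"

lemma limit_perm_eq: "limit_perm X Xh Y1 Y2 chi \<omega> = infty_concat (\<lambda>n. X n \<omega>) (limit_set \<omega>)"
  by (simp add: limit_perm_def limit_set_def I1_set_eq I0_set_eq)

text \<open>The first gap reveals \<open>chi\<close>: under \<open>good\<close> it is 0 exactly if
  \<open>chi\<close> is 1. It thus costs 1/2, which is \<open>crit 0\<close>, or else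
  \<open>1/2 * (2 * crit y)\<close>, so it has the same weight as the later gaps. These start in the
  first run with \<open>c = 1\<close>.\<close>

lemma covered_limit_word: "covered {\<omega> \<in> space M. good \<omega> \<and> limit_word (length w) \<omega> = w} (word_weight w)"
proof (cases w)
  case Nil
  then show ?thesis
    unfolding covered_def by (intro bexI[of _ "space M"]) (auto simp: prob_space word_weight_def)
next
  case (Cons p w')
  let ?r = "length w"
  obtain x y where p: "p = (x, y)" by (cases p)
  define K where "K = insert Idx_chi (Idx_X ` {1..?r})"
  define A where "A i = (case i of Idx_X j \<Rightarrow> {fst (w ! (j - 1))} | _ \<Rightarrow> {if y = 0 then 1 else 0::nat})" for i
  have K: "finite K" "K \<subseteq> rv_indices" by (auto simp: K_def rv_indices_def)
  have "(\<Prod>i\<in>K. pr i (A i)) = pr Idx_chi (A Idx_chi) * (\<Prod>i\<in>Idx_X ` {1..?r}. pr i (A i))"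
    unfolding K_def by (subst prod.insert) auto
  also have "(\<Prod>i\<in>Idx_X ` {1..?r}. pr i (A i)) = (\<Prod>j\<in>{1..?r}. crit (fst (w ! (j - 1))))"
    using X_law by (subst prod.reindex) (auto simp: inj_on_def A_def pr_def intro!: prod.cong)
  also have "\<dots> = (\<Prod>(x, y)\<leftarrow>w. crit x)"
    unfolding prod.list_conv_set_nth
    by (rule prod.reindex_bij_witness[of _ Suc "\<lambda>j. j - 1"]) (auto simp: case_prod_beta)
  also have "pr Idx_chi (A Idx_chi) = 1/2"
    using chi_0 chi_1 by (simp add: pr_def A_def)
  finally have prodK: "(\<Prod>i\<in>K. pr i (A i)) = 1/2 * (\<Prod>(x, y)\<leftarrow>w. crit x)" .
  have weight: "word_weight w = (\<Prod>(x, y)\<leftarrow>w. crit x) * (crit y * (\<Prod>y\<leftarrow>map snd w'. crit y))"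
  proof -
    have "word_weight u = (\<Prod>(x, y)\<leftarrow>u. crit x) * (\<Prod>y\<leftarrow>map snd u. crit y)" for u
      by (induction u) (auto simp: word_weight_def)
    then show ?thesis by (simp add: Cons p)
  qed
  let ?S = "{\<omega> \<in> space M. good \<omega> \<and> limit_word ?r \<omega> = w}"
  have S: "\<omega> \<in> constraint K A \<and> good \<omega> \<and> 1 \<le> Y1 1 \<omega> \<and> (if y = 0 then gaps_at \<omega> 1 1 1 0 (map snd w')
      else y = (\<Sum>i=0+1..0 + Y2 1 \<omega>. Xh i \<omega>) \<and> gaps_at \<omega> 1 2 1 (Y2 1 \<omega>) (map snd w'))" if "\<omega> \<in> ?S" for \<omega>
  proof -
    from that have \<omega>: "\<omega> \<in> space M" "good \<omega>" "limit_word ?r \<omega> = w" by auto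
    define d where "d = (if chi \<omega> = 1 then 0 else 1::nat)"
    let ?I = "run_set d (\<lambda>i. Xh i \<omega>) (\<lambda>i. Y1 i \<omega>) (\<lambda>i. Y2 i \<omega>)"
    have I: "limit_set \<omega> = ?I" by (simp add: limit_set_def d_def)
    have pos: "1 \<le> Y1 i \<omega>" "1 \<le> Y2 i \<omega>" "1 \<le> Xh i \<omega>" if "1 \<le> i" for i
      using that \<omega>(2) by (auto simp: good_def)
    have "[0..<?r] = 0 # [1..<1 + length w']" by (simp add: Cons upt_rec)
    then have gaps: "y = gap ?I 0" "map snd w' = map (gap ?I) [1..<1 + length w']"
      using arg_cong[OF \<omega>(3), of "map snd"] by (simp_all add: limit_word_def I Cons p o_def)
    have X: "X (Suc j) \<omega> = fst (w ! j)" if "j < ?r" for j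
      using that arg_cong[OF \<omega>(3), of "\<lambda>u. fst (u ! j)"] by (simp add: limit_word_def)
    have y: "y = partial_sum (\<lambda>i. Xh i \<omega>) (partial_sum (\<lambda>i. Y2 i \<omega>) d)"
      unfolding gaps by (rule gap_0) (rule pos)
    have gf: "gaps_at \<omega> (Suc 0) (Suc 0 + d) 1 (partial_sum (\<lambda>i. Y2 i \<omega>) d) (map snd w')"
      unfolding gaps(2) using pos by (intro gaps_from_gap) auto
    have Xh: "1 \<le> partial_sum (\<lambda>i. Xh i \<omega>) (Y2 1 \<omega>)"
      using pos le_partial_sum[of "\<lambda>i. Xh i \<omega>" "Y2 1 \<omega>"] by (meson order_refl order_trans)
    have chi: "chi \<omega> = (if y = 0 then 1 else 0)"
      using \<omega>(2) y Xh unfolding good_def d_def by (cases "chi \<omega> = 1") auto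
    then have d: "d = (if y = 0 then 0 else 1)" by (simp add: d_def)
    have "\<omega> \<in> constraint K A"
    proof -
      have "X j \<omega> = fst (w ! (j - 1))" if "j \<in> {1..?r}" for j
        using X[of "j - 1"] that by auto
      then show ?thesis using \<omega>(1) chi by (auto simp: constraint_def K_def A_def)
    qed
    moreover have "(\<Sum>i=0+1..0 + Y2 1 \<omega>. Xh i \<omega>) = partial_sum (\<lambda>i. Xh i \<omega>) (Y2 1 \<omega>)"
      by (simp add: partial_sum_def)
    moreover have "gaps_at \<omega> 1 1 1 0 (map snd w')" if "y = 0"
    proof -
      have "d = 0" using d that by simp
      show ?thesis using gf unfolding \<open>d = 0\<close> by (simp only: add_0_right partial_sum_0 One_nat_def)
    qed
    moreover have "y = partial_sum (\<lambda>i. Xh i \<omega>) (Y2 1 \<omega>) \<and> gaps_at \<omega> 1 2 1 (Y2 1 \<omega>) (map snd w')" if "y \<noteq> 0"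
    proof -
      have "d = 1" using d that by simp
      have ps: "partial_sum (\<lambda>i. Y2 i \<omega>) 1 = Y2 1 \<omega>" by (simp add: partial_sum_def)
      have two: "Suc 0 + 1 = 2" by simp
      show ?thesis
        using y gf unfolding \<open>d = 1\<close> ps two by (simp only: One_nat_def simp_thms)
    qed
    moreover have "1 \<le> Y1 1 \<omega>" by (rule pos) simp
    ultimately show ?thesis
      using \<omega>(2) by (cases "y = 0") (simp_all only: if_True if_False simp_thms)
  qed
  \<comment> \<open>If the set starts with a skip, \<open>Y2 1\<close> and the first
    \<open>Xh\<close> variables are used up by it, and the later gaps begin with the second
    \<open>Y2\<close> variable.\<close>
  have cov: "covered (if y = 0 then {\<omega> \<in> constraint K A. good \<omega> \<and> 1 \<le> Y1 1 \<omega> \<and> gaps_at \<omega> 1 1 1 0 (map snd w')}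
      else {\<omega> \<in> constraint K A. good \<omega> \<and> y = (\<Sum>i=0+1..0 + Y2 1 \<omega>. Xh i \<omega>) \<and> (1 \<le> Y1 1 \<omega> \<and> gaps_at \<omega> 1 2 1 (0 + Y2 1 \<omega>) (map snd w'))})
      ((\<Prod>i\<in>K. pr i (A i)) * (2 * crit y) * ((1/2) ^ (1 - 1) * (\<Prod>y\<leftarrow>map snd w'. crit y)))"
  proof (cases "y = 0")
    case True
    have "covered {\<omega> \<in> constraint K A. good \<omega> \<and> 1 \<le> Y1 1 \<omega> \<and> gaps_at \<omega> 1 1 1 0 (map snd w')}
        ((\<Prod>i\<in>K. pr i (A i)) * ((1/2) ^ (1 - 1) * (\<Prod>y\<leftarrow>map snd w'. crit y)))"
      
    proof (rule covered_gaps_from[OF order_refl order_refl order_refl K])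
    qed (auto simp: K_def)
    then show ?thesis using True by (simp add: crit_def)
  next
    case False
    have "covered {\<omega> \<in> constraint K A. good \<omega> \<and> y = (\<Sum>i=0+1..0 + Y2 1 \<omega>. Xh i \<omega>)
           \<and> (\<lambda>k \<omega>. 1 \<le> Y1 1 \<omega> \<and> gaps_at \<omega> 1 2 1 (0 + k) (map snd w')) (Y2 1 \<omega>) \<omega>}
        ((\<Prod>i\<in>K. pr i (A i)) * (2 * crit y) * ((1/2) ^ (1 - 1) * (\<Prod>y\<leftarrow>map snd w'. crit y)))"
    proof (rule covered_skip[OF K _ _ _ _ _ refl])
      fix l :: "nat list" and A'
      show "covered {\<omega> \<in> constraint (insert (Idx_Y2 1) (K \<union> Idx_Xh ` {0<..0 + length l})) A'. good \<omega> \<and> 1 \<le> Y1 1 \<omega> \<and> gaps_at \<omega> 1 2 1 (0 + length l) (map snd w')}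
          ((\<Prod>i\<in>insert (Idx_Y2 1) (K \<union> Idx_Xh ` {0<..0 + length l}). pr i (A' i)) * ((1/2) ^ (1 - 1) * (\<Prod>y\<leftarrow>map snd w'. crit y)))"
      proof (rule covered_gaps_from)
        show "insert (Idx_Y2 1) (K \<union> Idx_Xh ` {0<..0 + length l}) \<subseteq> rv_indices"
          using K(2) by (auto simp: rv_indices_def)
      qed (auto simp: K_def)
    qed (use False in \<open>auto simp: K_def\<close>)
    then show ?thesis using False by simp
  qed
  then show ?thesis
  proof (rule covered_mono)
    show "(\<Prod>i\<in>K. pr i (A i)) * (2 * crit y) * ((1/2) ^ (1 - 1) * (\<Prod>y\<leftarrow>map snd w'. crit y)) \<le> word_weight w"
      unfolding prodK weight by simp
  qed (use S in auto)
qed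

end

section \<open>The topology of the space of generalised permutations\<close>

lemma infsum_half_atLeast_le: "(\<Sum>\<^sub>\<infinity>k\<in>{m..}. (1/2::real) ^ k) \<le> 2 * (1/2) ^ m"
proof (rule infsum_le_finite_sums[OF half_summable])
  have sum: "(\<Sum>k=m..<m + N. (1/2::real) ^ k) = 2 * (1/2) ^ m - 2 * (1/2) ^ (m + N)" for N
    by (induction N) auto
  fix F :: "nat set" assume F: "finite F" "F \<subseteq> {m..}"
  then obtain N where "\<forall>n\<in>F. n \<le> N" using finite_nat_set_iff_bounded_le by blast
  then have "F \<subseteq> {m..<m + Suc N}" using F(2) by fastforce
  then have "(\<Sum>k\<in>F. (1/2::real) ^ k) \<le> (\<Sum>k=m..<m + Suc N. (1/2) ^ k)"
    by (intro sum_mono2) auto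
  also have "\<dots> \<le> 2 * (1/2) ^ m" unfolding sum by simp
  finally show "(\<Sum>k\<in>F. (1/2::real) ^ k) \<le> 2 * (1/2) ^ m" .
qed

lemma infsum_half_subset_le:
  assumes "A \<subseteq> {m..}"
  shows "(\<Sum>\<^sub>\<infinity>k\<in>A. (1/2::real) ^ k) \<le> 2 * (1/2) ^ m"
proof -
  have "(\<Sum>\<^sub>\<infinity>k\<in>A. (1/2::real) ^ k) \<le> (\<Sum>\<^sub>\<infinity>k\<in>{m..}. (1/2) ^ k)"
    by (rule infsum_mono_neutral) (use assms in \<open>auto simp: half_summable\<close>)
  then show ?thesis using infsum_half_atLeast_le[of m] by linarith
qed

text \<open>Two values above \<open>r\<close> are both close to \<infinity> in
  \<open>d_Nstar\<close>, hence close to each other.\<close>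

definition close_upto :: "nat \<Rightarrow> (nat \<Rightarrow> enat) \<Rightarrow> (nat \<Rightarrow> enat) \<Rightarrow> bool" where
  "close_upto r \<rho> \<sigma> \<longleftrightarrow> (\<forall>i\<in>{1..r}. \<rho> i = \<sigma> i \<or> enat r < \<rho> i \<and> enat r < \<sigma> i)"

text \<open>The 6 is 4 + 2. The first \<open>r\<close> coordinates have distance at most
  \<open>2 * (1/2) ^ r\<close> and weights of sum at most 2; the others have distance at most 2 and
  weights of sum at most \<open>2 * (1/2) ^ Suc r\<close>.\<close>

lemma D_ext_close_upto_le:
  assumes "close_upto r \<rho> \<sigma>"
  shows "D_ext \<rho> \<sigma> \<le> 6 * (1/2) ^ r"
proof -
  let ?t = "\<lambda>i. (1/2) ^ i * d_Nstar (\<rho> i) (\<sigma> i)"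
  have le2: "d_Nstar i j \<le> 2" for i j
    using infsum_half_subset_le[of _ 0] unfolding d_Nstar_def by auto
  have small: "d_Nstar (\<rho> i) (\<sigma> i) \<le> 2 * (1/2) ^ r" if "i \<in> {1..r}" for i
  proof (cases "\<rho> i = \<sigma> i")
    case True
    then have "d_Nstar (\<rho> i) (\<sigma> i) = 0" by (simp add: d_Nstar_eq_0)
    then show ?thesis by simp
  next
    case False
    then have "enat r < min (\<rho> i) (\<sigma> i)" using assms that by (auto simp: close_upto_def)
    have "r \<le> k" if "min (\<rho> i) (\<sigma> i) \<le> enat k" for k
    proof -
      have "enat r < enat k" using \<open>enat r < min (\<rho> i) (\<sigma> i)\<close> that by (rule less_le_trans)
      then show ?thesis by simp
    qed
    then have "{k. min (\<rho> i) (\<sigma> i) \<le> enat k \<and> enat k < max (\<rho> i) (\<sigma> i)} \<subseteq> {r..}" by blast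
    then show ?thesis unfolding d_Nstar_def by (rule infsum_half_subset_le)
  qed
  have split: "{1..} = {1..r} \<union> {Suc r..}" by auto
  have "D_ext \<rho> \<sigma> = infsum ?t {1..r} + infsum ?t {Suc r..}"
    unfolding D_ext_def split by (rule infsum_Un_disjoint) (auto simp: D_ext_summable)
  also have "infsum ?t {1..r} \<le> (\<Sum>\<^sub>\<infinity>i\<in>{1..r}. (2 * (1/2) ^ r) * (1/2) ^ i)"
  proof (rule infsum_mono)
    fix i assume "i \<in> {1..r}"
    then show "?t i \<le> (2 * (1/2) ^ r) * (1/2) ^ i" using small[of i] by (simp add: mult.commute mult_left_mono)
  qed (simp_all add: D_ext_summable)
  also have "\<dots> = (2 * (1/2) ^ r) * (\<Sum>\<^sub>\<infinity>i\<in>{1..r}. (1/2) ^ i)"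
    by (rule infsum_cmult_right) (simp add: half_summable)
  also have "\<dots> \<le> (2 * (1/2) ^ r) * (2 * (1/2) ^ 0)"
    by (intro mult_left_mono infsum_half_subset_le) auto
  also have "infsum ?t {Suc r..} \<le> (\<Sum>\<^sub>\<infinity>i\<in>{Suc r..}. 2 * (1/2) ^ i)"
  proof (rule infsum_mono)
    fix i
    show "?t i \<le> 2 * (1/2) ^ i" using le2[of "\<rho> i" "\<sigma> i"] by (simp add: mult.commute mult_left_mono)
  qed (auto intro!: summable_on_cmult_right half_summable D_ext_summable)
  also have "\<dots> = 2 * (\<Sum>\<^sub>\<infinity>i\<in>{Suc r..}. (1/2) ^ i)"
    by (rule infsum_cmult_right) (simp add: half_summable)
  also have "\<dots> \<le> 2 * (2 * (1/2) ^ Suc r)"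
    by (intro mult_left_mono infsum_half_subset_le) auto
  finally show ?thesis by simp
qed

lemma openin_S_top_close_upto:
  assumes U: "openin S_top U" "\<sigma> \<in> U"
  shows "\<exists>r0. \<forall>r\<ge>r0. \<forall>\<rho>\<in>S_ext. close_upto r \<rho> \<sigma> \<longrightarrow> \<rho> \<in> U"
proof -
  interpret Metric_space S_ext D_ext by (rule Metric_space_S_ext)
  obtain e where e: "e > 0" "mball \<sigma> e \<subseteq> U" and "\<sigma> \<in> S_ext"
    using U unfolding openin_mtopology by blast
  have "(\<lambda>r. 6 * (1/2::real) ^ r) \<longlonglongrightarrow> 6 * 0"
    by (intro tendsto_mult tendsto_const LIMSEQ_realpow_zero) auto
  then have "eventually (\<lambda>r. 6 * (1/2::real) ^ r < e) sequentially"
    using e(1) by (intro order_tendstoD) auto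
  then obtain r0 where r0: "\<And>r. r \<ge> r0 \<Longrightarrow> 6 * (1/2::real) ^ r < e"
    by (auto simp: eventually_sequentially)
  have "\<rho> \<in> U" if "r \<ge> r0" "\<rho> \<in> S_ext" "close_upto r \<rho> \<sigma>" for r \<rho>
  proof -
    have "D_ext \<sigma> \<rho> < e"
      using D_ext_close_upto_le[OF that(3)] r0[OF that(1)] commute[of \<sigma> \<rho>] by linarith
    then have "\<rho> \<in> mball \<sigma> e" using \<open>\<sigma> \<in> S_ext\<close> that by (simp add: in_mball)
    then show ?thesis using e(2) by blast
  qed
  then show ?thesis by blast
qed

lemma measurable_map_count_space:
  fixes g :: "'i \<Rightarrow> 'a \<Rightarrow> 'b :: countable"
  assumes "\<And>i. i \<in> set is \<Longrightarrow> g i \<in> measurable M (count_space UNIV)"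
  shows "(\<lambda>\<omega>. map (\<lambda>i. g i \<omega>) is) \<in> measurable M (count_space UNIV)"
  using assms
proof (induction "is")
  case (Cons i "is")
  have "(\<lambda>\<omega>. g i \<omega> # l) \<in> measurable M (count_space UNIV)" for l
    using Cons.prems by (intro measurable_compose[OF _ measurable_count_space]) auto
  then have "(\<lambda>\<omega>. g i \<omega> # map (\<lambda>i. g i \<omega>) is) \<in> measurable M (count_space UNIV)"
    using Cons.IH Cons.prems
    by (intro measurable_compose_countable[where f = "\<lambda>l \<omega>. g i \<omega> # l" and g = "\<lambda>\<omega>. map (\<lambda>i. g i \<omega>) is"]) auto
  then show ?case by simp
qed simp

text \<open>Its values lie in a countable type, yet it determines a point up to
  \<open>close_upto r\<close>.\<close>

definition truncation :: "nat \<Rightarrow> (nat \<Rightarrow> enat) \<Rightarrow> enat list" where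
  "truncation r \<rho> = map (\<lambda>i. if \<rho> i \<le> enat r then \<rho> i else \<infinity>) [1..<Suc r]"

lemma truncation_close_upto: "truncation r \<rho> = truncation r \<sigma> \<Longrightarrow> close_upto r \<rho> \<sigma>"
  unfolding truncation_def close_upto_def
  by (auto simp: not_le[symmetric] atLeastLessThanSuc_atLeastAtMost split: if_splits)

text \<open>A point of an open set \<open>U\<close> is detected at some \<open>r\<close> for which
  all points with the same \<open>truncation r\<close> lie in \<open>U\<close>. So \<open>U\<close>
  is a countable union of sets described by truncations, and measurable coordinates suffice.\<close>

lemma measurable_S_topI:
  assumes T: "T \<in> space M \<rightarrow> S_ext"
    and coord: "\<And>i. 1 \<le> i \<Longrightarrow> (\<lambda>\<omega>. T \<omega> i) \<in> measurable M (count_space UNIV)"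
  shows "T \<in> measurable M (borel_of S_top)"
  unfolding borel_of_def
proof (rule measurable_measure_of)
  fix U assume "U \<in> {U. openin S_top U}"
  then have U: "openin S_top U" by simp
  define V where "V r = {t. \<forall>\<rho>\<in>S_ext. truncation r \<rho> = t \<longrightarrow> \<rho> \<in> U}" for r
  have "T \<omega> \<in> U \<longleftrightarrow> (\<exists>r. truncation r (T \<omega>) \<in> V r)" if "\<omega> \<in> space M" for \<omega>
  proof
    assume "T \<omega> \<in> U"
    then obtain r0 where "\<forall>\<rho>\<in>S_ext. close_upto r0 \<rho> (T \<omega>) \<longrightarrow> \<rho> \<in> U"
      using openin_S_top_close_upto[OF U] by blast
    then have "truncation r0 (T \<omega>) \<in> V r0" by (auto simp: V_def truncation_close_upto)
    then show "\<exists>r. truncation r (T \<omega>) \<in> V r" ..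
  qed (use T that in \<open>auto simp: V_def\<close>)
  then have eq: "T -` U \<inter> space M = (\<Union>r. (\<lambda>\<omega>. truncation r (T \<omega>)) -` V r \<inter> space M)" by auto
  have "(\<lambda>\<omega>. truncation r (T \<omega>)) \<in> measurable M (count_space UNIV)" for r
    unfolding truncation_def
  proof (rule measurable_map_count_space)
    fix i assume "i \<in> set [1..<Suc r]"
    then show "(\<lambda>\<omega>. if T \<omega> i \<le> enat r then T \<omega> i else \<infinity>) \<in> measurable M (count_space UNIV)"
      by (intro measurable_compose[OF coord[of i] measurable_count_space, of "\<lambda>u. if u \<le> enat r then u else \<infinity>"]) auto
  qed
  then have "(\<lambda>\<omega>. truncation r (T \<omega>)) -` V r \<inter> space M \<in> sets M" for r
    by (rule measurable_sets) simp
  then show "T -` U \<inter> space M \<in> sets M"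
    unfolding eq by (intro sets.countable_UN) blast
next
  show "{U. openin S_top U} \<subseteq> Pow (topspace S_top)" by (auto dest: openin_subset[THEN subsetD])
next
  show "T \<in> space M \<rightarrow> topspace S_top" using T by simp
qed

lemma continuous_map_borel_measurable:
  assumes "continuous_map X euclideanreal f"
  shows "f \<in> borel_measurable (borel_of X)"
proof (rule borel_measurableI)
  fix S :: "real set" assume "open S"
  then have "openin X {x \<in> topspace X. f x \<in> S}"
    using assms by (simp add: continuous_map_def)
  moreover have "f -` S \<inter> space (borel_of X) = {x \<in> topspace X. f x \<in> S}" by (auto simp: space_borel_of)
  ultimately show "f -` S \<inter> space (borel_of X) \<in> sets (borel_of X)" by (auto simp: sets_borel_of)
qed

section \<open>The infinite concatenation as a point of the space\<close>

abbreviation concat_blocks :: "(nat \<Rightarrow> nat) \<Rightarrow> nat set \<Rightarrow> nat \<Rightarrow> enat list" where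
  "concat_blocks J I n \<equiv> replicate (J n) \<infinity> @ [enat (enumerate I (n - 1))]"

lemma flat_smap_fromN:
  assumes "\<And>n. f n \<noteq> []"
  shows "flat (smap f (fromN a)) = concat (map f [a..<a + r]) @- flat (smap f (fromN (a + r)))"
proof (induction r arbitrary: a)
  case (Suc r)
  have "flat (smap f (fromN a)) = f a @- flat (smap f (fromN (Suc a)))"
    by (subst siterate.code) (simp add: assms)
  also have "\<dots> = concat (map f (a # [Suc a..<Suc a + r])) @- flat (smap f (fromN (Suc a + r)))"
    unfolding Suc.IH[of "Suc a"] by simp
  also have "a # [Suc a..<Suc a + r] = [a..<a + Suc r]" by (simp add: upt_conv_Cons)
  finally show ?case by simp
qed simp

lemma map_infty_concat:
  assumes "infinite I"
  shows "map (infty_concat J I) [1..<Suc (length (concat (map (concat_blocks J I) [1..<1 + r])))]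
    = concat (map (concat_blocks J I) [1..<1 + r])" (is "map _ [1..<Suc (length ?L)] = _")
proof (intro nth_equalityI)
  fix i assume "i < length (map (infty_concat J I) [1..<Suc (length ?L)])"
  then have i: "i < length ?L" by simp
  have "infty_concat J I (Suc i) = flat (smap (concat_blocks J I) (fromN 1)) !! i"
    using assms by (simp add: infty_concat_def)
  also have "\<dots> = ?L ! i"
  proof -
    have "flat (smap (concat_blocks J I) (fromN 1)) = ?L @- flat (smap (concat_blocks J I) (fromN (1 + r)))"
      by (rule flat_smap_fromN) simp
    then show ?thesis using i by (simp only: shift_snth_less)
  qed
  finally show "map (infty_concat J I) [1..<Suc (length ?L)] ! i = ?L ! i" using i by simp
qed simp

lemma length_concat_blocks: "r \<le> length (concat (map (concat_blocks J I) [1..<1 + r]))"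
  by (induction r) (auto simp: upt_Suc)

lemma listing_gap:
  assumes I: "infinite I" "0 \<notin> I"
  shows "listing 0 (map (\<lambda>j. (J (Suc j), gap I j)) [0..<r]) = concat (map (concat_blocks J I) [1..<1 + r])"
proof -
  have "listing (if a = 0 then 0 else enumerate I (a - 1)) (map (\<lambda>j. (J (Suc j), gap I j)) [a..<a + r])
      = concat (map (concat_blocks J I) [Suc a..<Suc a + r])" for a
  proof (induction r arbitrary: a)
    case (Suc r)
    \<comment> \<open>Since 0 is not in \<open>I\<close>, the truncated subtraction in the first gap
      is exact.\<close>
    have "enumerate I 0 \<noteq> 0" using enumerate_in_set[OF I(1), of 0] I(2) by metis
    then have "(if a = 0 then 0 else enumerate I (a - 1)) + gap I a + 1 = enumerate I a"
    proof (cases "a = 0")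
      case False
      then have "enumerate I (a - 1) < enumerate I a" by (intro enumerate_mono I(1)) simp
      with False show ?thesis unfolding gap_def if_not_P[OF False] by linarith
    qed (simp add: gap_def)
    moreover have "[a..<a + Suc r] = a # [Suc a..<Suc a + r]" "[Suc a..<Suc a + Suc r] = Suc a # [Suc (Suc a)..<Suc (Suc a) + r]"
      by (simp_all add: upt_conv_Cons)
    ultimately show ?case using Suc.IH[of "Suc a"] by simp
  qed simp
  from this[of 0] show ?thesis by simp
qed

text \<open>Every block is nonempty, so \<open>r\<close> blocks reach position \<open>r\<close>. A
  single coordinate is thereby a function of a finite word.\<close>

lemma infty_concat_nth:
  assumes "infinite I" "0 \<notin> I" "1 \<le> i" "i \<le> r"
  shows "infty_concat J I i = listing 0 (map (\<lambda>j. (J (Suc j), gap I j)) [0..<r]) ! (i - 1)"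
proof -
  let ?L = "concat (map (concat_blocks J I) [1..<1 + r])"
  have i: "i - 1 < length ?L" using length_concat_blocks[of r J I] assms(3,4) by linarith
  then have "map (infty_concat J I) [1..<Suc (length ?L)] ! (i - 1) = infty_concat J I (1 + (i - 1))"
    by (simp add: nth_map)
  then show ?thesis
    unfolding map_infty_concat[OF assms(1)] listing_gap[OF assms(1,2)] using assms(3) by simp
qed

lemma distinct_filter_nth:
  assumes "distinct (filter P xs)" "i < j" "j < length xs" "P (xs ! i)"
  shows "xs ! i \<noteq> xs ! j"
proof
  assume eq: "xs ! i = xs ! j"
  have "xs = take i xs @ xs ! i # drop (Suc i) xs"
    using assms(2,3) by (intro id_take_nth_drop) simp
  then have "filter P xs = filter P (take i xs) @ xs ! i # filter P (drop (Suc i) xs)"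
    using assms(4) by (metis filter.simps(2) filter_append)
  moreover have "xs ! j \<in> set (drop (Suc i) xs)"
    using assms(2,3) by (auto simp: in_set_conv_nth intro!: exI[of _ "j - Suc i"])
  ultimately show False using assms(1,4) eq by auto
qed

lemma infty_concat_value:
  assumes "infinite I" "1 \<le> i" "infty_concat J I i \<noteq> \<infinity>"
  shows "infty_concat J I i \<in> enat ` I"
proof -
  let ?L = "concat (map (concat_blocks J I) [1..<1 + i])"
  have i: "i - 1 < length ?L" using length_concat_blocks[of i J I] assms(2) by linarith
  then have "map (infty_concat J I) [1..<Suc (length ?L)] ! (i - 1) = infty_concat J I (1 + (i - 1))"
    by (simp add: nth_map)
  then have "infty_concat J I i \<in> set ?L"
    unfolding map_infty_concat[OF assms(1)] using nth_mem[OF i] assms(2) by simp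
  then show ?thesis using assms(3) enumerate_in_set[OF assms(1)] by (auto split: if_splits)
qed

text \<open>With the infinite entries filtered out, a prefix lists distinct elements of
  \<open>I\<close>; this gives injectivity on the finite values.\<close>

lemma infty_concat_S_ext:
  assumes "0 \<notin> I"
  shows "infty_concat J I \<in> S_ext"
proof (cases "infinite I")
  case False
  then show ?thesis by (auto simp: S_ext_def infty_concat_def inj_on_def)
next
  case True
  have "infty_concat J I i \<ge> 1" if i: "1 \<le> i" for i
  proof (cases "infty_concat J I i = \<infinity>")
    case False
    then obtain v where "infty_concat J I i = enat v" "v \<in> I"
      using infty_concat_value[OF True i, of J] by auto
    then show ?thesis using assms by (cases v) (auto simp: one_enat_def)
  qed simp
  moreover have "infty_concat J I i \<noteq> infty_concat J I j"
    if "1 \<le> i" "i < j" "infty_concat J I i \<noteq> \<infinity>" for i j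
  proof -
    let ?L = "concat (map (concat_blocks J I) [1..<1 + j])"
    have len: "j \<le> length ?L" by (rule length_concat_blocks)
    have nth: "?L ! (k - 1) = infty_concat J I k" if "1 \<le> k" "k \<le> j" for k
    proof -
      have "?L ! (k - 1) = map (infty_concat J I) [1..<Suc (length ?L)] ! (k - 1)"
        unfolding map_infty_concat[OF True] ..
      also have "\<dots> = infty_concat J I (1 + (k - 1))" using that len by (subst nth_map) auto
      finally show ?thesis using that by simp
    qed
    have "filter (\<lambda>u. u \<noteq> \<infinity>) (concat (map (concat_blocks J I) ns)) = map (\<lambda>n. enat (enumerate I (n - 1))) ns" for ns
      by (induction ns) auto
    moreover have "inj_on (\<lambda>n. enat (enumerate I (n - 1))) (set [1..<1 + j])"
    proof (rule inj_onI)
      fix m n assume "m \<in> set [1..<1 + j]" "n \<in> set [1..<1 + j]"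
        "enat (enumerate I (m - 1)) = enat (enumerate I (n - 1))"
      then have "1 \<le> m" "1 \<le> n" "m - 1 = n - 1" using injD[OF inj_enumerate[OF True]] by auto
      then show "m = n" by linarith
    qed
    ultimately have "distinct (filter (\<lambda>u. u \<noteq> \<infinity>) ?L)"
      by (simp only: distinct_map distinct_upt simp_thms)
    then have "?L ! (i - 1) \<noteq> ?L ! (j - 1)"
    proof (rule distinct_filter_nth)
      show "i - 1 < j - 1" "j - 1 < length ?L" using that len by linarith+
      show "?L ! (i - 1) \<noteq> \<infinity>" using nth[of i] that by simp
    qed
    then show ?thesis using nth[of i] nth[of j] that by simp
  qed
  then have "inj_on (infty_concat J I) ({1..} \<inter> infty_concat J I -` (enat ` {1..}))"
    by (intro linorder_inj_onI') auto
  moreover have "infty_concat J I \<in> extensional {1..}" by (simp add: infty_concat_def)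
  ultimately show ?thesis by (auto simp: S_ext_def PiE_def)
qed

section \<open>Weak convergence\<close>

lemma measurable_binop_count_space:
  fixes f :: "'a \<Rightarrow> 'b" and g :: "'a \<Rightarrow> 'c :: countable"
  assumes f: "f \<in> measurable M (count_space UNIV)" and g: "g \<in> measurable M (count_space UNIV)"
  shows "(\<lambda>\<omega>. h (f \<omega>) (g \<omega>)) \<in> measurable M (count_space UNIV)"
proof (rule measurable_compose_countable[where f = "\<lambda>v \<omega>. h (f \<omega>) v" and g = g, OF _ g])
  show "(\<lambda>\<omega>. h (f \<omega>) v) \<in> measurable M (count_space UNIV)" for v
    by (rule measurable_compose[OF f]) simp
qed

lemma measurable_partial_sum:
  assumes "\<And>i. 1 \<le> i \<Longrightarrow> (\<lambda>\<omega>. a i \<omega>) \<in> measurable M (count_space UNIV)"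
  shows "(\<lambda>\<omega>. partial_sum (\<lambda>i. a i \<omega>) n) \<in> measurable M (count_space UNIV)"
proof (induction n)
  case (Suc n)
  show ?case unfolding partial_sum_Suc
    by (rule measurable_binop_count_space[where h = "(+)", OF Suc.IH assms]) simp
qed simp

lemma measurable_enumerate:
  fixes A :: "'a \<Rightarrow> nat set"
  assumes "\<And>v. Measurable.pred M (\<lambda>\<omega>. v \<in> A \<omega>)"
  shows "(\<lambda>\<omega>. enumerate (A \<omega>) j) \<in> measurable M (count_space UNIV)"
  using assms
proof (induction j arbitrary: A)
  case 0
  show ?case unfolding enumerate_0 by (rule measurable_Least) (rule 0)
next
  case (Suc j)
  have least: "(\<lambda>\<omega>. LEAST n. n \<in> A \<omega>) \<in> measurable M (count_space UNIV)"
    by (rule measurable_Least) (rule Suc.prems)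
  show ?case unfolding enumerate_Suc
  proof (rule Suc.IH)
    fix v
    have "Measurable.pred M (\<lambda>\<omega>. v \<noteq> (LEAST n. n \<in> A \<omega>))"
      by (rule measurable_compose[OF least]) simp
    then show "Measurable.pred M (\<lambda>\<omega>. v \<in> A \<omega> - {LEAST n. n \<in> A \<omega>})"
      using Suc.prems[of v] by simp
  qed
qed

lemma ennreal_less_INF_of_all_less:
  assumes "\<And>x. x \<in> A \<Longrightarrow> (z::ennreal) < F x" "y < z"
  shows "y < (INF x\<in>A. F x)"
  by (rule less_le_trans[OF assms(2)]) (intro INF_greatest less_imp_le assms(1))

text \<open>The second lower bound is an upper bound for the limes superior of \<open>a\<close>. The
  shift by \<open>B\<close> makes both quantities nonnegative, as Fatou's lemma in
  \<open>ennreal\<close> demands.\<close>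

lemma LIMSEQ_if_liminf_both:
  fixes a :: "nat \<Rightarrow> real"
  assumes B: "\<And>n. \<bar>a n\<bar> \<le> B" "\<bar>l\<bar> \<le> B"
    and "ennreal (l + B) \<le> liminf (\<lambda>n. ennreal (a n + B))" "ennreal (B - l) \<le> liminf (\<lambda>n. ennreal (B - a n))"
  shows "a \<longlonglongrightarrow> l"
proof (rule order_tendstoI)
  fix c assume "c < l"
  show "eventually (\<lambda>n. c < a n) sequentially"
  \<comment> \<open>For such \<open>c\<close> the conversion to \<open>ennreal\<close> would cut
    \<open>c + B\<close> off at 0, but the claim is immediate.\<close>
  proof (cases "c < - B")
    case True
    then have "c < a n" for n using B(1)[of n] by linarith
    then show ?thesis by simp
  next
    case False
    with \<open>c < l\<close> have "ennreal (c + B) < ennreal (l + B)" by (intro ennreal_lessI) auto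
    then have "eventually (\<lambda>n. ennreal (c + B) < ennreal (a n + B)) sequentially"
      using assms(3) by (intro less_LiminfD) (rule less_le_trans)
    then show ?thesis using False by (auto elim!: eventually_mono simp: ennreal_less_iff)
  qed
next
  fix c assume "l < c"
  show "eventually (\<lambda>n. a n < c) sequentially"
  proof (cases "c > B")
    case True
    then have "a n < c" for n using B(1)[of n] by linarith
    then show ?thesis by simp
  next
    case False
    with \<open>l < c\<close> have "ennreal (B - c) < ennreal (B - l)" by (intro ennreal_lessI) auto
    then have "eventually (\<lambda>n. ennreal (B - c) < ennreal (B - a n)) sequentially"
      using assms(4) by (intro less_LiminfD) (rule less_le_trans)
    then show ?thesis using False by (auto elim!: eventually_mono simp: ennreal_less_iff)
  qed
qed

section \<open>Measurability of the limit and passage to the limit\<close>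

context limit_variables
begin

lemma pred_limit_set: "Measurable.pred M (\<lambda>\<omega>. v \<in> limit_set \<omega>)"
proof -
  define d where "d \<omega> = (if chi \<omega> = 1 then 0 else 1::nat)" for \<omega>
  define A where "A n \<omega> = partial_sum (\<lambda>i. Xh i \<omega>) (partial_sum (\<lambda>i. Y2 i \<omega>) (n + d \<omega>))" for n \<omega>
  have d: "d \<in> measurable M (count_space UNIV)"
    unfolding d_def by (rule measurable_compose[OF chi_measurable]) simp
  have Y1: "(\<lambda>\<omega>. partial_sum (\<lambda>i. Y1 i \<omega>) n) \<in> measurable M (count_space UNIV)" for n
    by (intro measurable_partial_sum Y1_measurable)
  have "(\<lambda>\<omega>. partial_sum (\<lambda>i. Y2 i \<omega>) (n + k)) \<in> measurable M (count_space UNIV)" for n k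
    by (intro measurable_partial_sum Y2_measurable)
  then have N: "(\<lambda>\<omega>. partial_sum (\<lambda>i. Y2 i \<omega>) (n + d \<omega>)) \<in> measurable M (count_space UNIV)" for n
    by (rule measurable_compose_countable) (rule d)
  have "(\<lambda>\<omega>. partial_sum (\<lambda>i. Xh i \<omega>) k) \<in> measurable M (count_space UNIV)" for k
    by (intro measurable_partial_sum Xh_measurable)
  then have A: "A n \<in> measurable M (count_space UNIV)" for n
    unfolding A_def by (rule measurable_compose_countable) (rule N)
  have "v \<in> limit_set \<omega> \<longleftrightarrow> (\<exists>n. partial_sum (\<lambda>i. Y1 i \<omega>) n + A n \<omega> + 1 \<le> v \<and> v \<le> partial_sum (\<lambda>i. Y1 i \<omega>) (n + 1) + A n \<omega>)" for \<omega>
    by (simp add: limit_set_def run_set_def A_def d_def)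
  moreover have "Measurable.pred M (\<lambda>\<omega>. partial_sum (\<lambda>i. Y1 i \<omega>) n + A n \<omega> + 1 \<le> v)" for n
    by (rule measurable_binop_count_space[OF Y1 A])
  moreover have "Measurable.pred M (\<lambda>\<omega>. v \<le> partial_sum (\<lambda>i. Y1 i \<omega>) (n + 1) + A n \<omega>)" for n
    by (rule measurable_binop_count_space[OF Y1 A])
  ultimately show ?thesis by (simp only: pred_intros_countable pred_intros_logic)
qed

lemma measurable_limit_word: "limit_word r \<in> measurable M (count_space UNIV)"
  unfolding limit_word_def
proof (rule measurable_map_count_space)
  fix j
  have enum: "(\<lambda>\<omega>. enumerate (limit_set \<omega>) i) \<in> measurable M (count_space UNIV)" for i
    by (rule measurable_enumerate) (rule pred_limit_set)
  have "(\<lambda>\<omega>. gap (limit_set \<omega>) j) \<in> measurable M (count_space UNIV)"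
    unfolding gap_def by (rule measurable_binop_count_space[OF enum enum])
  then show "(\<lambda>\<omega>. (X (Suc j) \<omega>, gap (limit_set \<omega>) j)) \<in> measurable M (count_space UNIV)"
    by (intro measurable_binop_count_space[of _ _ _ Pair] X_measurable) simp_all
qed

lemma zero_notin_limit_set: "0 \<notin> limit_set \<omega>"
  by (auto simp: limit_set_def run_set_def)

lemma limit_perm_in_S_ext: "limit_perm X Xh Y1 Y2 chi \<omega> \<in> S_ext"
  unfolding limit_perm_eq by (rule infty_concat_S_ext) (rule zero_notin_limit_set)

lemma limit_perm_nth:
  assumes "infinite (limit_set \<omega>)" "1 \<le> i"
  shows "limit_perm X Xh Y1 Y2 chi \<omega> i = listing 0 (limit_word i \<omega>) ! (i - 1)"
  unfolding limit_perm_eq limit_word_def using assms zero_notin_limit_set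
  by (intro infty_concat_nth) auto

lemma limit_perm_measurable: "limit_perm X Xh Y1 Y2 chi \<in> measurable M (borel_of S_top)"
proof (rule measurable_S_topI)
  fix i :: nat assume i: "1 \<le> i"
  have inf: "Measurable.pred M (\<lambda>\<omega>. infinite (limit_set \<omega>))"
    unfolding infinite_nat_iff_unbounded using pred_limit_set
    by (intro pred_intros_countable pred_intros_logic) auto
  \<comment> \<open>The default \<infinity> covers the outcomes with a finite set, so measurability
    holds on all of \<open>space M\<close>, not only under \<open>good\<close>.\<close>
  have eq: "limit_perm X Xh Y1 Y2 chi \<omega> i
      = (\<lambda>b w. if b then listing 0 w ! (i - 1) else \<infinity>) (infinite (limit_set \<omega>)) (limit_word i \<omega>)" for \<omega>
    using i limit_perm_nth[of \<omega> i] by (auto simp: limit_perm_eq infty_concat_def)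
  show "(\<lambda>\<omega>. limit_perm X Xh Y1 Y2 chi \<omega> i) \<in> measurable M (count_space UNIV)"
    unfolding eq by (rule measurable_binop_count_space[OF inf measurable_limit_word])
qed (simp add: limit_perm_in_S_ext)

lemma infinite_limit_set: "good \<omega> \<Longrightarrow> infinite (limit_set \<omega>)"
  unfolding limit_set_def by (rule infinite_run_set) (auto simp: good_def)

lemma listing_limit_word:
  assumes "good \<omega>"
  shows "listing 0 (limit_word r \<omega>) = concat (map (concat_blocks (\<lambda>n. X n \<omega>) (limit_set \<omega>)) [1..<1 + r])"
  unfolding limit_word_def
  by (rule listing_gap[where J = "\<lambda>n. X n \<omega>", OF infinite_limit_set[OF assms] zero_notin_limit_set])

lemma map_limit_perm:
  assumes "good \<omega>"
  shows "map (limit_perm X Xh Y1 Y2 chi \<omega>) [1..<Suc (length (listing 0 (limit_word r \<omega>)))] = listing 0 (limit_word r \<omega>)"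
  unfolding limit_perm_eq listing_limit_word[OF assms]
  by (rule map_infty_concat) (rule infinite_limit_set[OF assms])

lemma word_cylinder_close_upto:
  assumes "good \<omega>" "\<rho> \<in> word_cylinder r (limit_word r \<omega>)"
  shows "close_upto r \<rho> (limit_perm X Xh Y1 Y2 chi \<omega>)"
  unfolding close_upto_def
proof
  fix i assume i: "i \<in> {1..r}"
  let ?L = "listing 0 (limit_word r \<omega>)" and ?\<sigma> = "limit_perm X Xh Y1 Y2 chi \<omega>"
  have "r \<le> length ?L"
    unfolding listing_limit_word[OF assms(1)]
    by (rule length_concat_blocks)
  then have len: "i - 1 < length ?L" using i by auto
  have "list_all2 (entry_match r) (map \<rho> [1..<Suc (length ?L)]) (map ?\<sigma> [1..<Suc (length ?L)])"
    using assms(2) unfolding map_limit_perm[OF assms(1)] by (simp add: word_cylinder_def)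
  then have "entry_match r (map \<rho> [1..<Suc (length ?L)] ! (i - 1)) (map ?\<sigma> [1..<Suc (length ?L)] ! (i - 1))"
    by (rule list_all2_nthD) (use len in simp)
  then have "entry_match r (\<rho> i) (?\<sigma> i)" using len i by simp
  then show "\<rho> i = ?\<sigma> i \<or> enat r < \<rho> i \<and> enat r < ?\<sigma> i"
    by (auto simp: entry_match_def split: if_splits)
qed

lemma emeasure_limit_word_le: "emeasure M {\<omega> \<in> space M. limit_word (length w) \<omega> = w} \<le> ennreal (word_weight w)"
proof -
  obtain E where E: "E \<in> events" "{\<omega> \<in> space M. good \<omega> \<and> limit_word (length w) \<omega> = w} \<subseteq> E" "prob E \<le> word_weight w"
    using covered_limit_word[of w] by (auto simp: covered_def)
  have "emeasure M {\<omega> \<in> space M. limit_word (length w) \<omega> = w} \<le> emeasure M E"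
  proof (rule emeasure_mono_AE[OF _ E(1)])
    show "AE \<omega> in M. \<omega> \<in> {\<omega> \<in> space M. limit_word (length w) \<omega> = w} \<longrightarrow> \<omega> \<in> E"
      using AE_good by eventually_elim (use E(2) in auto)
  qed
  also have "\<dots> \<le> ennreal (word_weight w)"
    unfolding emeasure_eq_measure using E(3) by (rule ennreal_leI)
  finally show ?thesis .
qed

text \<open>The integral is split by the value of the discrete variable \<open>limit_word r\<close>;
  after exchanging sum and integral, each word is bounded by
  \<open>emeasure_limit_word_le\<close>.\<close>

lemma nn_integral_limit_word_le:
  "(\<integral>\<^sup>+\<omega>. G (limit_word r \<omega>) \<partial>M) \<le> (\<integral>\<^sup>+w. ennreal (word_weight w) * G w \<partial>count_space {w. length w = r})"
proof -
  let ?W = "count_space {w::(nat \<times> nat) list. length w = r}"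
  have sets: "{\<omega> \<in> space M. limit_word r \<omega> = w} \<in> events" for w
    by (rule count_space_events[OF measurable_limit_word])
  have meas: "(\<lambda>\<omega>. G w * indicator {\<omega> \<in> space M. limit_word r \<omega> = w} \<omega>) \<in> borel_measurable M" for w
    using sets[of w] by measurable
  have "(\<integral>\<^sup>+\<omega>. G (limit_word r \<omega>) \<partial>M) = (\<integral>\<^sup>+\<omega>. (\<integral>\<^sup>+w. G w * indicator {\<omega> \<in> space M. limit_word r \<omega> = w} \<omega> \<partial>?W) \<partial>M)"
  proof (rule nn_integral_cong)
    fix \<omega> assume "\<omega> \<in> space M"
    then have "(\<integral>\<^sup>+w. G w * indicator {\<omega> \<in> space M. limit_word r \<omega> = w} \<omega> \<partial>?W)
        = (\<integral>\<^sup>+w. G (limit_word r \<omega>) * indicator {limit_word r \<omega>} w \<partial>?W)"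
      by (intro nn_integral_cong) (auto simp: indicator_def)
    also have "\<dots> = G (limit_word r \<omega>)"
      by (subst nn_integral_cmult_indicator) (auto simp: limit_word_def)
    finally show "G (limit_word r \<omega>) = (\<integral>\<^sup>+w. G w * indicator {\<omega> \<in> space M. limit_word r \<omega> = w} \<omega> \<partial>?W)" ..
  qed
  also have "\<dots> = (\<integral>\<^sup>+w. (\<integral>\<^sup>+\<omega>. G w * indicator {\<omega> \<in> space M. limit_word r \<omega> = w} \<omega> \<partial>M) \<partial>?W)"
    by (rule nn_integral_count_space_nn_integral) (simp_all add: meas)
  also have "\<dots> \<le> (\<integral>\<^sup>+w. ennreal (word_weight w) * G w \<partial>?W)"
  proof (rule nn_integral_mono)
    fix w :: "(nat \<times> nat) list" assume "w \<in> space ?W"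
    then have "length w = r" by simp
    then show "(\<integral>\<^sup>+\<omega>. G w * indicator {\<omega> \<in> space M. limit_word r \<omega> = w} \<omega> \<partial>M) \<le> ennreal (word_weight w) * G w"
      using emeasure_limit_word_le[of w] nn_integral_cmult_indicator[OF sets, of "G w" w]
      by (simp add: mult.commute[of "ennreal (word_weight w)"] mult_left_mono)
  qed
  finally show ?thesis .
qed

text \<open>Fatou's lemma is used twice: over words of fixed length \<open>r\<close> as \<open>n \<rightarrow> \<infinity>\<close>, and over
  the probability space as \<open>r \<rightarrow> \<infinity>\<close>; this replaces uniform continuity, hence compactness of the space.\<close>

lemma nn_integral_limit_le_liminf:
  assumes h: "continuous_map S_top euclideanreal h" and B: "\<And>\<rho>. \<rho> \<in> S_ext \<Longrightarrow> 0 \<le> h \<rho>"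
  shows "(\<integral>\<^sup>+\<omega>. ennreal (h (limit_perm X Xh Y1 Y2 chi \<omega>)) \<partial>M)
    \<le> liminf (\<lambda>n. \<integral>\<^sup>+x. ennreal (h x) \<partial>mu [2, 1, 3] n)"
proof -
  let ?L = "limit_perm X Xh Y1 Y2 chi"
  \<comment> \<open>The infimum is a lower bound for \<open>h\<close> that depends on the word
    alone. The cap \<open>r\<close> keeps it finite, since over an empty cylinder the infimum is
    \<infinity>; it is harmless because \<open>r\<close> grows.\<close>
  define G where "G r w = min (of_nat r) (INF \<rho>\<in>word_cylinder r w. ennreal (h \<rho>))" for r w
  have lower: "AE \<omega> in M. ennreal (h (?L \<omega>)) \<le> liminf (\<lambda>r. G r (limit_word r \<omega>))"
    using AE_good
  proof eventually_elim
    case (elim \<omega>)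
    show ?case unfolding le_Liminf_iff
    proof (intro allI impI)
      fix y assume "y < ennreal (h (?L \<omega>))"
      \<comment> \<open>The intermediate \<open>z\<close> preserves strictness: values above
        \<open>z\<close> have an infimum of at least \<open>z\<close>, which is above
        \<open>y\<close>.\<close>
      then obtain z where z: "y < z" "z < ennreal (h (?L \<omega>))" using dense by blast
      define U where "U = {\<rho> \<in> S_ext. h \<rho> \<in> {enn2real z<..}}"
      have "z < \<top>" using z(2) by (rule less_trans) simp
      then have zz: "z = ennreal (enn2real z)" by simp
      have "openin S_top U"
        using openin_continuous_map_preimage[OF h, of "{enn2real z<..}"] by (simp add: U_def)
      moreover have "enn2real z < h (?L \<omega>)"
        using z(2) by (subst (asm) zz) (simp add: ennreal_less_iff)
      then have "?L \<omega> \<in> U" using limit_perm_in_S_ext by (simp add: U_def)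
      ultimately obtain r0 where r0: "\<forall>r\<ge>r0. \<forall>\<rho>\<in>S_ext. close_upto r \<rho> (?L \<omega>) \<longrightarrow> \<rho> \<in> U"
        by (metis openin_S_top_close_upto)
      have "y < \<top>" using z(1) by (rule less_trans) (rule \<open>z < \<top>\<close>)
      then obtain r1 where r1: "y < of_nat r1" using ennreal_Ex_less_of_nat[of y] by auto
      show "eventually (\<lambda>r. y < G r (limit_word r \<omega>)) sequentially"
        using eventually_ge_at_top[of "max r0 r1"]
      proof eventually_elim
        case (elim r)
        have "y < of_nat r" using elim by (intro less_le_trans[OF r1]) (simp add: of_nat_mono)
        moreover have "y < (INF \<rho>\<in>word_cylinder r (limit_word r \<omega>). ennreal (h \<rho>))"
        proof (rule ennreal_less_INF_of_all_less[OF _ z(1)])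
          fix \<rho> assume \<rho>: "\<rho> \<in> word_cylinder r (limit_word r \<omega>)"
          then have "\<rho> \<in> U"
            using elim by (intro r0[rule_format] word_cylinder_close_upto[OF \<open>good \<omega>\<close>]) (auto simp: word_cylinder_def)
          then show "z < ennreal (h \<rho>)"
            unfolding U_def by (subst zz) (simp add: ennreal_less_iff)
        qed
        ultimately show ?case by (simp add: G_def)
      qed
    qed
  qed
  have F: "(\<lambda>\<rho>. ennreal (h \<rho>)) \<in> borel_measurable (borel_of S_top)"
    using continuous_map_borel_measurable[OF h] by simp
  have fixed: "(\<integral>\<^sup>+\<omega>. G r (limit_word r \<omega>) \<partial>M) \<le> liminf (\<lambda>n. \<integral>\<^sup>+x. ennreal (h x) \<partial>mu [2, 1, 3] n)" for r
  proof -
    have "G r w \<le> ennreal (h \<rho>)" if "\<rho> \<in> word_cylinder r w" for w \<rho>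
      unfolding G_def using that by (intro min.coboundedI2 INF_lower)
    moreover have "G r w < \<top>" for w
      unfolding G_def by (rule le_less_trans[OF min.cobounded1]) (simp add: of_nat_less_top)
    ultimately have "(\<integral>\<^sup>+w. ennreal (word_weight w) * G r w \<partial>count_space {w. length w = r})
        \<le> liminf (\<lambda>n. \<integral>\<^sup>+x. ennreal (h x) \<partial>mu [2, 1, 3] n)"
      by (intro word_sum_le_liminf_mu[OF F]) auto
    with nn_integral_limit_word_le show ?thesis by (rule order_trans)
  qed
  have "(\<integral>\<^sup>+\<omega>. ennreal (h (?L \<omega>)) \<partial>M) \<le> (\<integral>\<^sup>+\<omega>. liminf (\<lambda>r. G r (limit_word r \<omega>)) \<partial>M)"
    by (rule nn_integral_mono_AE[OF lower])
  also have "\<dots> \<le> liminf (\<lambda>r. \<integral>\<^sup>+\<omega>. G r (limit_word r \<omega>) \<partial>M)"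
    by (rule nn_integral_liminf) (rule measurable_compose[OF measurable_limit_word], simp)
  also have "\<dots> \<le> liminf (\<lambda>n. \<integral>\<^sup>+x. ennreal (h x) \<partial>mu [2, 1, 3] n)"
  proof -
    have "liminf (\<lambda>r. \<integral>\<^sup>+\<omega>. G r (limit_word r \<omega>) \<partial>M)
        \<le> liminf (\<lambda>r::nat. liminf (\<lambda>n. \<integral>\<^sup>+x. ennreal (h x) \<partial>mu [2, 1, 3] n))"
      by (intro Liminf_mono always_eventually allI fixed)
    then show ?thesis by (simp add: Liminf_const)
  qed
  finally show ?thesis .
qed

lemma integral_mu_tendsto:
  assumes f: "continuous_map S_top euclideanreal f" and bdd: "bounded (f ` S_ext)"
  shows "(\<lambda>n. \<integral>x. f x \<partial>mu [2, 1, 3] n) \<longlonglongrightarrow> (\<integral>x. f x \<partial>distr M (borel_of S_top) (limit_perm X Xh Y1 Y2 chi))"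
proof -
  let ?N = "distr M (borel_of S_top) (limit_perm X Xh Y1 Y2 chi)"
  obtain B where B: "\<And>\<rho>. \<rho> \<in> S_ext \<Longrightarrow> \<bar>f \<rho>\<bar> \<le> B"
    using bdd by (auto simp: bounded_iff)
  have meas: "f \<in> borel_measurable (borel_of S_top)" by (rule continuous_map_borel_measurable[OF f])
  have N: "prob_space ?N" by (rule prob_space_distr[OF limit_perm_measurable])
  \<comment> \<open>Stated for any probability measure \<open>P\<close>, to serve both
    \<open>mu\<close> and the limit law; mass 1 lets the constant \<open>B\<close> leave the
    integrals unchanged.\<close>
  have integ: "integrable P f" and bound: "\<bar>\<integral>x. f x \<partial>P\<bar> \<le> B"
    and plus: "(\<integral>\<^sup>+x. ennreal (f x + B) \<partial>P) = ennreal ((\<integral>x. f x \<partial>P) + B)"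
    and minus: "(\<integral>\<^sup>+x. ennreal (B - f x) \<partial>P) = ennreal (B - (\<integral>x. f x \<partial>P))"
    if P: "prob_space P" "sets P = sets (borel_of S_top)" for P
  proof -
    interpret P: prob_space P by (rule P(1))
    have space: "space P = S_ext" using sets_eq_imp_space_eq[OF P(2)] by simp
    have "f \<in> borel_measurable P" using meas measurable_cong_sets[OF P(2) refl] by blast
    then show int: "integrable P f"
      by (intro P.integrable_const_bound[of _ B] AE_I2) (auto simp: space B)
    have "\<bar>\<integral>x. f x \<partial>P\<bar> \<le> (\<integral>x. \<bar>f x\<bar> \<partial>P)" using integral_norm_bound[of P f] by simp
    also have "\<dots> \<le> (\<integral>x. B \<partial>P)" using int by (intro integral_mono) (auto simp: space B)
    finally show "\<bar>\<integral>x. f x \<partial>P\<bar> \<le> B" by (simp add: P.prob_space)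
    have "(\<integral>\<^sup>+x. ennreal (f x + B) \<partial>P) = ennreal (\<integral>x. f x + B \<partial>P)"
      using int by (intro nn_integral_eq_integral AE_I2) (auto simp: space dest!: B)
    then show "(\<integral>\<^sup>+x. ennreal (f x + B) \<partial>P) = ennreal ((\<integral>x. f x \<partial>P) + B)"
      using int by (simp add: P.prob_space)
    have "(\<integral>\<^sup>+x. ennreal (B - f x) \<partial>P) = ennreal (\<integral>x. B - f x \<partial>P)"
      using int by (intro nn_integral_eq_integral AE_I2) (auto simp: space dest!: B)
    then show "(\<integral>\<^sup>+x. ennreal (B - f x) \<partial>P) = ennreal (B - (\<integral>x. f x \<partial>P))"
      using int by (simp add: P.prob_space)
  qed
  have transfer: "(\<integral>\<^sup>+\<omega>. ennreal (h (limit_perm X Xh Y1 Y2 chi \<omega>)) \<partial>M) = (\<integral>\<^sup>+x. ennreal (h x) \<partial>?N)"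
    if "h \<in> borel_measurable (borel_of S_top)" for h
    using that by (subst nn_integral_distr[OF limit_perm_measurable]) auto
  show ?thesis
  proof (rule LIMSEQ_if_liminf_both[where B = B])
    show "\<bar>\<integral>x. f x \<partial>mu [2, 1, 3] n\<bar> \<le> B" for n
      by (rule bound[OF prob_space_mu sets_mu])
    show "\<bar>\<integral>x. f x \<partial>?N\<bar> \<le> B" by (rule bound[OF N]) simp
    have "continuous_map S_top euclideanreal (\<lambda>x. f x + B)" using f by (intro continuous_intros) auto
    moreover have "0 \<le> f \<rho> + B" if "\<rho> \<in> S_ext" for \<rho> using B[OF that] by linarith
    ultimately have "(\<integral>\<^sup>+\<omega>. ennreal (f (limit_perm X Xh Y1 Y2 chi \<omega>) + B) \<partial>M)
        \<le> liminf (\<lambda>n. \<integral>\<^sup>+x. ennreal (f x + B) \<partial>mu [2, 1, 3] n)"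
      by (rule nn_integral_limit_le_liminf)
    then show "ennreal ((\<integral>x. f x \<partial>?N) + B) \<le> liminf (\<lambda>n. ennreal ((\<integral>x. f x \<partial>mu [2, 1, 3] n) + B))"
      unfolding plus[OF prob_space_mu sets_mu] 
      by (simp only: transfer[OF borel_measurable_add[OF meas borel_measurable_const]] plus[OF N sets_distr])
    have "continuous_map S_top euclideanreal (\<lambda>x. B - f x)" using f by (intro continuous_intros) auto
    moreover have "0 \<le> B - f \<rho>" if "\<rho> \<in> S_ext" for \<rho> using B[OF that] by linarith
    ultimately have "(\<integral>\<^sup>+\<omega>. ennreal (B - f (limit_perm X Xh Y1 Y2 chi \<omega>)) \<partial>M)
        \<le> liminf (\<lambda>n. \<integral>\<^sup>+x. ennreal (B - f x) \<partial>mu [2, 1, 3] n)"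
      by (rule nn_integral_limit_le_liminf)
    then show "ennreal (B - (\<integral>x. f x \<partial>?N)) \<le> liminf (\<lambda>n. ennreal (B - (\<integral>x. f x \<partial>mu [2, 1, 3] n)))"
      unfolding minus[OF prob_space_mu sets_mu] 
      by (simp only: transfer[OF borel_measurable_diff[OF borel_measurable_const meas]] minus[OF N sets_distr])
  qed
qed

text \<open>Each \<open>X n\<close> vanishes with probability \<open>crit 0\<close>, which is 1/2,
  so the first \<open>N\<close> vanish together with probability \<open>(1/2) ^ N\<close>.\<close>

lemma AE_some_X_positive: "AE \<omega> in M. \<exists>n\<ge>1. X n \<omega> \<noteq> 0"
proof -
  let ?Z = "{\<omega> \<in> space M. \<forall>n\<ge>1. X n \<omega> = 0}"
  have Z: "?Z \<in> events"
  proof -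
    have "Measurable.pred M (\<lambda>\<omega>. X n \<omega> = 0)" if "1 \<le> n" for n
      by (rule measurable_compose[OF X_measurable[OF that]]) simp
    then have "Measurable.pred M (\<lambda>\<omega>. \<forall>n. n \<ge> 1 \<longrightarrow> X n \<omega> = 0)"
      by (intro pred_intros_countable pred_intros_imp') auto
    then show ?thesis by (rule predE)
  qed
  have "prob ?Z \<le> (1/2) ^ N" for N
  proof -
    have K: "finite (Idx_X ` {1..N})" "Idx_X ` {1..N} \<subseteq> rv_indices" by (auto simp: rv_indices_def)
    have "prob ?Z \<le> prob (constraint (Idx_X ` {1..N}) (\<lambda>_. {0}))"
      by (intro finite_measure_mono constraint_prob(1) K) (auto simp: constraint_def)
    also have "\<dots> = (\<Prod>n\<in>{1..N}. 1/2)"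
      unfolding constraint_prob(2)[OF K]
      by (subst prod.reindex) (auto simp: inj_on_def pr_def X_law crit_def intro!: prod.cong)
    finally show ?thesis by simp
  qed
  then have "prob ?Z \<le> 0"
    by (intro LIMSEQ_le_const[OF LIMSEQ_realpow_zero[of "1/2"]]) auto
  then have "prob ?Z = 0" by (meson measure_nonneg order_antisym)
  then have "AE \<omega> in M. \<omega> \<notin> ?Z" using prob_eq_0[OF Z] by simp
  then show ?thesis by (rule AE_mp) auto
qed

text \<open>A positive \<open>X n\<close> puts \<infinity> among the values, which excludes
  \<open>S_inj\<close>; a value removed by the first skip is never taken, which excludes
  \<open>S_sur\<close>.\<close>

lemma AE_limit_perm: "AE \<omega> in M. limit_perm X Xh Y1 Y2 chi \<omega> \<in> S_ext - S_inj - S_sur"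
  using AE_good AE_some_X_positive
proof eventually_elim
  case (elim \<omega>)
  let ?L = "limit_perm X Xh Y1 Y2 chi \<omega>"
  obtain n where n: "1 \<le> n" "X n \<omega> \<noteq> 0" using elim(2) by blast
  have "\<infinity> \<in> set (concat (map (concat_blocks (\<lambda>n. X n \<omega>) (limit_set \<omega>)) [1..<1 + n]))"
    using n by (auto intro!: bexI[of _ n])
  also have "\<dots> \<subseteq> ?L ` {1..}"
  proof -
    have "set (map ?L ns) \<subseteq> ?L ` {1..}" if "set ns \<subseteq> {1..}" for ns using that by auto
    then show ?thesis
      unfolding limit_perm_eq by (subst map_infty_concat[OF infinite_limit_set[OF elim(1)], symmetric]) auto
  qed
  finally obtain i where i: "i \<in> {1..}" "?L i = \<infinity>" by (metis imageE)
  have "?L \<notin> S_inj"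
  proof
    assume "?L \<in> S_inj"
    then have "?L i \<in> enat ` {1..}" using i(1) unfolding S_inj_def by (blast intro: PiE_mem)
    then show False using i(2) by auto
  qed
  moreover have "?L \<notin> S_sur"
  proof -
    have pos: "1 \<le> Y1 i \<omega>" "1 \<le> Y2 i \<omega>" "1 \<le> Xh i \<omega>" if "1 \<le> i" for i
      using elim(1) that by (auto simp: good_def)
    have "\<exists>v\<ge>1. v \<notin> limit_set \<omega>"
      unfolding limit_set_def by (rule run_set_missing) (simp_all add: pos del: One_nat_def)
    then obtain v where v: "1 \<le> v" "v \<notin> limit_set \<omega>" by blast
    have "enat v \<notin> ?L ` {1..}"
    proof
      assume "enat v \<in> ?L ` {1..}"
      then obtain i where i: "1 \<le> i" "enat v = ?L i" by auto
      have "?L i \<noteq> \<infinity>" unfolding i(2)[symmetric] by simp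
      with i(1) have "?L i \<in> enat ` limit_set \<omega>"
        unfolding limit_perm_eq by (intro infty_concat_value infinite_limit_set elim(1))
      then show False unfolding i(2)[symmetric] using v(2) by auto
    qed
    moreover have "enat v \<in> {1..}" using v(1) by (simp add: one_enat_def)
    ultimately show ?thesis by (auto simp: S_sur_def)
  qed
  ultimately show ?case using limit_perm_in_S_ext by blast
qed

end

theorem theorem3:
  fixes M :: "'w measure"
    and X Xh Y1 Y2 :: "nat \<Rightarrow> 'w \<Rightarrow> nat"
    and chi :: "'w \<Rightarrow> nat"
  assumes "prob_space M"
    and "prob_space.indep_vars M (\<lambda>_. count_space UNIV) (rv_family X Xh Y1 Y2 chi) rv_indices"
    and "\<And>n k. n \<ge> 1 \<Longrightarrow> measure M {\<omega> \<in> space M. X n \<omega> = k} = catalan k / (2 * 4 ^ k)"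
    and "\<And>n. n \<ge> 1 \<Longrightarrow>
           distr M (count_space UNIV) (Xh n) = distr M (count_space UNIV) (\<lambda>\<omega>. X 1 \<omega> + 1)"
    and "\<And>n k. n \<ge> 1 \<Longrightarrow> k \<ge> 1 \<Longrightarrow> measure M {\<omega> \<in> space M. Y1 n \<omega> = k} = (1/2) ^ k"
    and "\<And>n k. n \<ge> 1 \<Longrightarrow> k \<ge> 1 \<Longrightarrow> measure M {\<omega> \<in> space M. Y2 n \<omega> = k} = (1/2) ^ k"
    and "measure M {\<omega> \<in> space M. chi \<omega> = 0} = 1/2"
    and "measure M {\<omega> \<in> space M. chi \<omega> = 1} = 1/2"
  shows "limit_perm X Xh Y1 Y2 chi \<in> measurable M (borel_of S_top)
       \<and> weak_conv_on S_top (mu [2, 1, 3]) (distr M (borel_of S_top) (limit_perm X Xh Y1 Y2 chi))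
       \<and> (AE \<omega> in M. limit_perm X Xh Y1 Y2 chi \<omega> \<in> S_ext - S_inj - S_sur)"
proof -
  interpret prob_space M by (rule assms(1))
  interpret limit_variables M X Xh Y1 Y2 chi
    by (intro limit_variables.intro limit_variables_axioms.intro assms[folded crit_def])
  show ?thesis
    unfolding weak_conv_on_def topspace_S_top
    by (intro conjI allI impI limit_perm_measurable AE_limit_perm prob_space_mu sets_mu
        prob_space_distr sets_distr integral_mu_tendsto) auto
qed

end
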